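(* Let $q$ be a prime power, $\mathbb{F}$ an extension field of $\mathbb{F}_q$, $1\le k\le n$, and $\ell\ge 1$. An $[n,k]_{\mathbb{F}}$ linear code $C$ is $\mathrm{MRD}(\ell+1)$ if and only if its dual code $C^\perp$ is $\mathrm{LD}\text{-}\mathrm{MRD}(\le\ell)$.
   Context: An $[n,k]_{\mathbb{F}}$ code is a $k$-dimensional $\mathbb{F}$-subspace $C\subseteq\mathbb{F}^n$, with generator matrix $G\in\mathbb{F}^{k\times n}$ meaning $C=\{G^T\bm{u}\}$; $C^\perp=\{\bm{v}\in\mathbb{F}^n:\bm{v}^T\bm{c}=0\ \forall \bm{c}\in C\}$. For $\bm{v}\in\mathbb{F}^n$, $\mathrm{rank}_{\mathbb{F}_q}(\bm{v})=\dim_{\mathbb{F}_q}\mathrm{span}_{\mathbb{F}_q}\{v_1,\dots,v_n\}$ and $d_R(\bm{u},\bm{v})=\mathrm{rank}_{\mathbb{F}_q}(\bm{u}-\bm{v})$. For $V\subseteq\mathbb{F}_q^n$ an $\mathbb{F}_q$-subspace, $G_V$ is the $\mathbb{F}$-column span of $GA$ for any $A\in\mathbb{F}_q^{n\times\dim V}$ whose $\mathbb{F}_q$-column span is $V$. $C$ is $\mathrm{MRD}(\ell)$ if for all $\mathbb{F}_q$-subspaces $V_1,\dots,V_\ell\subseteq\mathbb{F}_q^n$ of dimension at most $k$, $\dim_{\mathbb{F}}(\bigcap_i G_{V_i})=\dim_{\mathbb{K}}(\bigcap_i W_{V_i})$, where $W=(Z_{i,j})_{i\in[k],j\in[n]}$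 over $\mathbb{K}=\mathbb{F}_q(Z_{1,1},\dots,Z_{k,n})$. An $[n,k']_{\mathbb{F}}$ code $D$ is $\mathrm{LD}\text{-}\mathrm{MRD}(L)$ if for every $\bm{y}\in\mathbb{F}^n$ and every $L+1$ distinct codewords $\bm{c}_0,\dots,\bm{c}_L\in D$, $\sum_{i=0}^L d_R(\bm{y},\bm{c}_i)>L(n-k')$; it is $\mathrm{LD}\text{-}\mathrm{MRD}(\le\ell)$ if it is $\mathrm{LD}\text{-}\mathrm{MRD}(L)$ for all $L\in[\ell]$. *)

theory Defs
  imports "HOL-Analysis.Analysis" "HOL-Library.Poly_Mapping" "HOL-Library.Countable_Set"
          "HOL-Computational_Algebra.Fraction_Field"
begin

(* The finite field F_q is a type 'q :: {finite, field} (so q = CARD('q) is a prime power).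
   The extension field F is a type 'f :: field together with a field embedding
   iota :: 'q => 'f.  Vectors of F^n are 'f^'n, k x n matrices are 'f^'n^'k. *)

definition field_embedding :: "('q::field \<Rightarrow> 'f::field) \<Rightarrow> bool" where
  "field_embedding \<iota> \<longleftrightarrow> \<iota> 1 = 1 \<and> (\<forall>a b. \<iota> (a + b) = \<iota> a + \<iota> b) \<and> (\<forall>a b. \<iota> (a * b) = \<iota> a * \<iota> b)"

definition rank_q :: "('q::field \<Rightarrow> 'f::field) \<Rightarrow> 'f^'n \<Rightarrow> nat" where
  "rank_q \<iota> v = vector_space.dim (\<lambda>c x. \<iota> c * x) (range (\<lambda>j. v $ j))"

definition d_R :: "('q::field \<Rightarrow> 'f::field) \<Rightarrow> 'f^'n \<Rightarrow> 'f^'n \<Rightarrow> nat" where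
  "d_R \<iota> u v = rank_q \<iota> (u - v)"

definition dual_code :: "('f::field^'n) set \<Rightarrow> ('f^'n) set" where
  "dual_code C = {v. \<forall>c\<in>C. (\<Sum>j\<in>UNIV. v $ j * c $ j) = 0}"

definition code_of :: "'f::field^'n^'k \<Rightarrow> ('f^'n) set" where
  "code_of G = {transpose G *v u | u. True}"

(* G_V: F-column span of G A, where the F_q-column span of A is V;
   i.e. the F-span of {G (iota v) | v in V} *)
definition G_sub :: "('q::field \<Rightarrow> 'f::field) \<Rightarrow> 'f^'n^'k \<Rightarrow> ('q^'n) set \<Rightarrow> ('f^'k) set" where
  "G_sub \<iota> G V = vec.span ((\<lambda>v. G *v (\<chi> j. \<iota> (v $ j))) ` V)"

(* K = F_q(Z_{1,1},...,Z_{k,n}): fraction field of the polynomial ring over F_q;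
   variables indexed by naturals, Z_{i,j} being the variable with index to_nat_on UNIV (i,j) *)
type_synonym 'q ratfun = "((nat \<Rightarrow>\<^sub>0 nat) \<Rightarrow>\<^sub>0 'q) fract"

definition ratfun_const :: "'q::field \<Rightarrow> 'q ratfun" where
  "ratfun_const c = Fract (Poly_Mapping.single 0 c) 1"

definition ratfun_var :: "nat \<Rightarrow> 'q::field ratfun" where
  "ratfun_var x = Fract (Poly_Mapping.single (Poly_Mapping.single x 1) 1) 1"

definition generic_matrix :: "('q::field ratfun)^'n^'k" where
  "generic_matrix = (\<chi> i j. ratfun_var (to_nat_on (UNIV :: ('k \<times> 'n) set) (i, j)))"

definition W_sub :: "('q::field^'n) set \<Rightarrow> ('q ratfun ^'k) set" where
  "W_sub V = vec.span ((\<lambda>v. (generic_matrix :: ('q ratfun)^'n^'k) *v (\<chi> j. ratfun_const (v $ j))) ` V)"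

definition MRD :: "('q::{finite,field} \<Rightarrow> 'f::field) \<Rightarrow> nat \<Rightarrow> 'f^'n^'k \<Rightarrow> bool" where
  "MRD \<iota> l G \<longleftrightarrow>
     (\<forall>Vs :: nat \<Rightarrow> ('q^'n) set.
        (\<forall>i\<in>{1..l}. vec.subspace (Vs i) \<and> vec.dim (Vs i) \<le> CARD('k)) \<longrightarrow>
        vec.dim (\<Inter>i\<in>{1..l}. G_sub \<iota> G (Vs i))
          = vec.dim (\<Inter>i\<in>{1..l}. (W_sub (Vs i) :: ('q ratfun ^'k) set)))"

definition LD_MRD :: "('q::field \<Rightarrow> 'f::field) \<Rightarrow> nat \<Rightarrow> ('f^'n) set \<Rightarrow> bool" where
  "LD_MRD \<iota> L D \<longleftrightarrow>
     (\<forall>y :: 'f^'n. \<forall>c :: nat \<Rightarrow> 'f^'n.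
        (\<forall>i\<in>{0..L}. c i \<in> D) \<and> inj_on c {0..L} \<longrightarrow>
        (\<Sum>i=0..L. d_R \<iota> y (c i)) > L * (CARD('n) - vec.dim D))"

definition LD_MRD_le :: "('q::field \<Rightarrow> 'f::field) \<Rightarrow> nat \<Rightarrow> ('f^'n) set \<Rightarrow> bool" where
  "LD_MRD_le \<iota> l D \<longleftrightarrow> (\<forall>L\<in>{1..l}. LD_MRD \<iota> L D)"

end

(* Fix subspaces V_1, ..., V_m of F_q^n of dimension at most k. For a labelling of the indices, let U_b be
   the intersection of the V_i with label b. If G is injective on the extensions of subspaces of dimension at
   most k, then dim (INT G_{V_i}) >= sum_b dim U_b - (number of labels - 1) k for every labelling, by counting.
   For the generic matrix W, equality holds for some labelling: a point s of the intersection is s = W e_i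
   with e_i in V_i, and differentiating in the entries of W shows that the annihilators of W_{V_i} are joint
   eigenspaces, with eigenvalue e_i, of operators that depend only on s. Labelling i by the map s -> e_i, the
   annihilators for distinct labels are independent, and they all annihilate the intersection.

   If C is MRD(l+1), a list violating the list-decoding bound is excluded by the same labelling formula for G.
   Conversely the list-decoding bound, applied to the distinct e_i over a single nonzero s, yields a labelling
   with sum_b dim U_b > (number of labels - 1) k; so INT G_{V_i} is nonzero only if INT W_{V_i} is. Cutting one
   V_i by hyperplanes upgrades this to an inequality between dimensions. *)
theory Submission
  imports Defs
begin

section \<open>Annihilators and dimension counts\<close>

lemma dual_code_subspace: "vec.subspace (dual_code X)"
  by (auto simp: vec.subspace_def dual_code_def algebra_simps sum.distrib simp flip: sum_distrib_left)

text \<open>A vector x of S with nonzero pairing spans S together with the kernel: subtracting a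
  suitable multiple of x makes the pairing vanish.\<close>

lemma dim_kernel_functional_ge:
  fixes S :: "('a::field^'m) set"
  assumes "vec.subspace S"
  shows "vec.dim S \<le> Suc (vec.dim (S \<inter> dual_code {b}))"
proof (cases "S \<subseteq> dual_code {b}")
  case True
  then show ?thesis by (simp add: inf.absorb1)
next
  case False
  define p where "p v = (\<Sum>j\<in>UNIV. v $ j * b $ j)" for v
  have pm: "p (v - c *s w) = p v - c * p w" for v w c
    by (simp add: p_def algebra_simps sum_subtractf sum_distrib_left)
  obtain x where x: "x \<in> S" "p x \<noteq> 0"
    using False by (auto simp: dual_code_def p_def)
  have "S \<subseteq> vec.span (insert x (S \<inter> dual_code {b}))"
  proof
    fix v assume v: "v \<in> S"
    let ?c = "p v / p x"
    have "v - ?c *s x \<in> S \<inter> dual_code {b}"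
      using v x assms pm[of v ?c x]
      by (auto simp: dual_code_def p_def[symmetric] vec.subspace_diff vec.subspace_scale)
    then show "v \<in> vec.span (insert x (S \<inter> dual_code {b}))"
      using vec.span_breakdown_eq vec.span_base by blast
  qed
  then have "vec.dim S \<le> vec.dim (insert x (S \<inter> dual_code {b}))"
    by (rule vec.dim_mono)
  then show ?thesis by (auto simp: vec.dim_insert split: if_splits)
qed

lemma dim_dual_code_ge:
  fixes B :: "('a::field^'m) set"
  assumes "finite B"
  shows "CARD('m) \<le> vec.dim (dual_code B) + card B"
  using assms
proof (induction B)
  case empty
  have "dual_code {} = (UNIV :: ('a^'m) set)" by (auto simp: dual_code_def)
  then show ?case by (simp add: card_cart_basis)
next
  case (insert b B)
  have "dual_code (insert b B) = dual_code B \<inter> dual_code {b}"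
    by (auto simp: dual_code_def)
  then show ?case
    using insert dim_kernel_functional_ge[OF dual_code_subspace, of B b] by simp
qed

lemma dual_code_span: "dual_code (vec.span B) = dual_code B"
proof
  show "dual_code (vec.span B) \<subseteq> dual_code B"
    by (auto simp: dual_code_def vec.span_base)
  show "dual_code B \<subseteq> dual_code (vec.span B)"
  proof
    fix v assume v: "v \<in> dual_code B"
    have "(\<Sum>j\<in>UNIV. v $ j * c $ j) = 0" if "c \<in> vec.span B" for c
      using that
    proof (induction rule: vec.span_induct_alt)
      case base then show ?case by simp
    next
      case (step a x y)
      have "(\<Sum>j\<in>UNIV. v $ j * (a *s x + y) $ j)
          = a * (\<Sum>j\<in>UNIV. v $ j * x $ j) + (\<Sum>j\<in>UNIV. v $ j * y $ j)"
        by (simp add: ring_distribs mult.left_commute sum.distrib sum_distrib_left)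
      then show ?case using v step by (simp add: dual_code_def)
    qed
    then show "v \<in> dual_code (vec.span B)" by (auto simp: dual_code_def)
  qed
qed

lemma dim_Int_lower:
  fixes S T :: "('a::field^'m) set"
  assumes "vec.subspace S" "vec.subspace T"
  shows "vec.dim S + vec.dim T \<le> vec.dim (S \<inter> T) + CARD('m)"
  using vec.dim_sums_Int[OF assms] vec.dim_subset_UNIV[of "{x + y |x y. x \<in> S \<and> y \<in> T}"]
  by (simp add: card_cart_basis vec.dimension_def)

text \<open>A set and its annihilator may overlap because of isotropic vectors. Instead a basis
  \<open>B\<close> is completed to \<open>B'\<close>: the annihilators of \<open>B\<close> and
  \<open>B' - B\<close> meet only in 0, while each has at least the dimension predicted by counting
  equations, so both bounds are sharp.\<close>

lemma dim_dual_code: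
  fixes X :: "('a::field^'m) set"
  shows "vec.dim (dual_code X) + vec.dim X = CARD('m)"
proof -
  obtain B where B: "B \<subseteq> X" "vec.independent B" "X \<subseteq> vec.span B" "card B = vec.dim X"
    using vec.basis_exists by blast
  have spB: "vec.span B = vec.span X"
    using B by (metis vec.span_eq vec.span_superset subset_trans)
  have dX: "dual_code X = dual_code B" using dual_code_span[of X] dual_code_span[of B] spB by simp
  define B' where "B' = vec.extend_basis B"
  have B': "B \<subseteq> B'" "vec.independent B'" "vec.span B' = UNIV"
    using vec.extend_basis_superset[OF B(2)] vec.independent_extend_basis[OF B(2)]
      vec.span_extend_basis[OF B(2)] by (auto simp: B'_def)
  have fin: "finite B'" using B'(2) vec.finiteI_independent by blast
  have cB': "card B' = CARD('m)"
    using vec.dim_span_eq_card_independent[OF B'(2)] B'(3) by (simp add: card_cart_basis)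
  have "dual_code B \<inter> dual_code (B' - B) = dual_code B'"
    using B'(1) by (auto simp: dual_code_def)
  also have "\<dots> = dual_code UNIV" using dual_code_span[of B'] B'(3) by simp
  also have "\<dots> \<subseteq> {0}"
  proof
    fix v :: "'a^'m" assume v: "v \<in> dual_code UNIV"
    have "v $ i = 0" for i
    proof -
      have "(\<Sum>j\<in>UNIV. v $ j * (axis i 1 :: 'a^'m) $ j) = 0" using v by (simp add: dual_code_def)
      then show ?thesis by (simp add: axis_def if_distrib cong: if_cong)
    qed
    then show "v \<in> {0}" by (simp add: vec_eq_iff)
  qed
  finally have "vec.dim (dual_code B \<inter> dual_code (B' - B)) = 0"
    by (simp add: vec.dim_eq_0)
  then have "vec.dim (dual_code B) + vec.dim (dual_code (B' - B)) \<le> CARD('m)"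
    using dim_Int_lower[OF dual_code_subspace dual_code_subspace, of B "B' - B"] by (simp del: vec.dim_eq_0)
  moreover have "CARD('m) \<le> vec.dim (dual_code (B' - B)) + card (B' - B)"
    using fin by (intro dim_dual_code_ge) auto
  moreover have "card (B' - B) = CARD('m) - card B" "card B \<le> CARD('m)"
    using B' fin cB' by (auto simp: card_Diff_subset finite_subset intro: card_mono) (metis card_mono)
  moreover have "CARD('m) \<le> vec.dim (dual_code B) + card B"
    using fin B'(1) finite_subset by (intro dim_dual_code_ge) auto
  ultimately show ?thesis unfolding dX using B(4) by linarith
qed

text \<open>Codimension is subadditive under intersection; nonemptiness of \<open>B\<close> makes
  the truncated \<open>card B - 1\<close> exact.\<close>

lemma dim_INT_lower:
  fixes X :: "'b \<Rightarrow> ('a::field^'m) set"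
  assumes "finite B" "B \<noteq> {}" "\<And>b. b \<in> B \<Longrightarrow> vec.subspace (X b)"
  shows "(\<Sum>b\<in>B. vec.dim (X b)) \<le> vec.dim (\<Inter>b\<in>B. X b) + (card B - 1) * CARD('m)"
  using assms
proof (induction B rule: finite_ne_induct)
  case (singleton x)
  then show ?case by simp
next
  case (insert x F)
  have "vec.subspace (\<Inter>b\<in>F. X b)" using insert by (intro vec.subspace_Int) auto
  then have "vec.dim (X x) + vec.dim (\<Inter>b\<in>F. X b) \<le> vec.dim (X x \<inter> (\<Inter>b\<in>F. X b)) + CARD('m)"
    using insert by (intro dim_Int_lower) auto
  moreover have "card F = Suc (card F - 1)" using insert by (simp add: card_gt_0_iff)
  then have "card F * CARD('m) = (card F - 1) * CARD('m) + CARD('m)"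
    by (metis add.commute mult_Suc)
  ultimately show ?case using insert by simp
qed

text \<open>The last hypothesis makes the sum of the \<open>Y b\<close> direct. It will be applied
  to the annihilators attached to distinct labels.\<close>

lemma sum_dim_le_if_independent:
  fixes Y :: "'b \<Rightarrow> ('a::field^'m) set"
  assumes "finite B" "\<And>b. b \<in> B \<Longrightarrow> vec.subspace (Y b)" "\<And>b. b \<in> B \<Longrightarrow> Y b \<subseteq> T" "vec.subspace T"
    and "\<And>h. \<lbrakk>\<And>b. b \<in> B \<Longrightarrow> h b \<in> Y b; (\<Sum>b\<in>B. h b) = 0\<rbrakk> \<Longrightarrow> \<forall>b\<in>B. h b = 0"
  shows "(\<Sum>b\<in>B. vec.dim (Y b)) \<le> vec.dim T"
proof -
  define Z where "Z A = {\<Sum>b\<in>A. h b |h. \<forall>b\<in>A. h b \<in> Y b}" for A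
  have Z: "vec.subspace (Z A) \<and> (\<Sum>b\<in>A. vec.dim (Y b)) = vec.dim (Z A)" if "A \<subseteq> B" for A
    using finite_subset[OF that assms(1)] that
  proof (induction A)
    case empty
    then show ?case by (simp add: Z_def vec.subspace_0)
  next
    case (insert x F)
    then have IH: "vec.subspace (Z F)" "(\<Sum>b\<in>F. vec.dim (Y b)) = vec.dim (Z F)"
      and Yx: "vec.subspace (Y x)" using assms by auto
    have eq: "Z (insert x F) = {u + v |u v. u \<in> Y x \<and> v \<in> Z F}"
    proof (intro set_eqI iffI)
      fix z assume "z \<in> Z (insert x F)"
      then show "z \<in> {u + v |u v. u \<in> Y x \<and> v \<in> Z F}"
        using insert by (auto simp: Z_def)
    next
      fix z assume "z \<in> {u + v |u v. u \<in> Y x \<and> v \<in> Z F}"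
      then obtain u h where uh: "z = u + (\<Sum>b\<in>F. h b)" "u \<in> Y x" "\<forall>b\<in>F. h b \<in> Y b"
        by (auto simp: Z_def)
      have "(\<Sum>b\<in>F. (h(x := u)) b) = (\<Sum>b\<in>F. h b)"
        using insert by (intro sum.cong) auto
      then have "z = (\<Sum>b\<in>insert x F. (h(x := u)) b)" using uh insert by simp
      moreover have "\<forall>b\<in>insert x F. (h(x := u)) b \<in> Y b" using uh by simp
      ultimately show "z \<in> Z (insert x F)" unfolding Z_def by blast
    qed
    have "Y x \<inter> Z F \<subseteq> {0}"
    proof
      fix z assume z: "z \<in> Y x \<inter> Z F"
      then obtain h where h: "z = (\<Sum>b\<in>F. h b)" "\<forall>b\<in>F. h b \<in> Y b" by (auto simp: Z_def)
      \<comment> \<open>The entry \<open>- z\<close> at \<open>x\<close> turns a common element of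
        \<open>Y x\<close> and \<open>Z F\<close> into a vanishing sum over all of
        \<open>B\<close>.\<close>
      define g where "g b = (if b = x then - z else if b \<in> F then h b else 0)" for b
      have "(\<Sum>b\<in>B. g b) = (\<Sum>b\<in>insert x F. g b)"
        using insert assms(1) by (intro sum.mono_neutral_right) (auto simp: g_def)
      also have "\<dots> = g x + (\<Sum>b\<in>F. g b)" using insert by simp
      also have "(\<Sum>b\<in>F. g b) = z" unfolding h(1) using insert by (intro sum.cong) (auto simp: g_def)
      finally have "(\<Sum>b\<in>B. g b) = 0" by (simp add: g_def)
      moreover have "g b \<in> Y b" if "b \<in> B" for b
        using that z h assms(2) by (auto simp: g_def vec.subspace_0 vec.subspace_neg)
      ultimately have "\<forall>b\<in>B. g b = 0" using assms(5) by blast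
      then show "z \<in> {0}" using insert by (auto simp: g_def dest: bspec[of _ _ x])
    qed
    then have "vec.dim (Y x \<inter> Z F) = 0" by (simp add: vec.dim_eq_0)
    then have "vec.dim (Z (insert x F)) = vec.dim (Y x) + vec.dim (Z F)"
      using vec.dim_sums_Int[OF Yx IH(1)] eq by (simp del: vec.dim_eq_0)
    then show ?case using insert eq vec.subspace_sums[OF Yx IH(1)] IH by simp
  qed
  have "Z B \<subseteq> T"
    using assms(3,4) by (auto simp: Z_def intro!: vec.subspace_sum)
  then show ?thesis using Z[of B] vec.dim_subset by auto
qed

text \<open>Otherwise e extends to a basis of S, and the images of the other basis vectors, one too
  few, span the image.\<close>

lemma image_dim_eq_imp_zero:
  fixes S :: "('a::field^'m) set" and A :: "'a^'m^'r"
  assumes "vec.subspace S" "vec.dim S \<le> vec.dim ((*v) A ` S)" "e \<in> S" "A *v e = 0"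
  shows "e = 0"
proof (rule ccontr)
  assume "e \<noteq> 0"
  then obtain B where B: "{e} \<subseteq> B" "B \<subseteq> S" "vec.independent B" "S \<subseteq> vec.span B"
    using vec.maximal_independent_subset_extend[of "{e}" S] assms(3) by auto
  have fin: "finite B" using B(3) vec.finiteI_independent by blast
  have sp: "(*v) A ` S \<subseteq> vec.span ((*v) A ` B)"
    using B(4) by (auto simp: vec.linear_span_image[OF matrix_vector_mul_linear_gen])
  also have "(*v) A ` B = insert 0 ((*v) A ` (B - {e}))" using B(1) assms(4) by auto
  also have "vec.span \<dots> = vec.span ((*v) A ` (B - {e}))" by simp
  finally have "vec.dim ((*v) A ` S) \<le> card ((*v) A ` (B - {e}))"
    using fin by (intro vec.dim_le_card) auto
  also have "\<dots> \<le> card (B - {e})" using fin by (intro card_image_le) auto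
  also have "\<dots> < card B" using fin B(1) by (intro psubset_card_mono) auto
  also have "card B \<le> vec.dim S" using B by (simp add: vec.independent_card_le_dim)
  finally show False using assms(2) by simp
qed

text \<open>X + Y stays inside the span of p and Y, so it exceeds Y by at most one
  dimension.\<close>

lemma dim_le_Suc_Int:
  fixes X Y :: "('a::field^'m) set"
  assumes "vec.subspace X" "vec.subspace Y" "X \<subseteq> vec.span (insert p Y)"
  shows "vec.dim X \<le> Suc (vec.dim (X \<inter> Y))"
proof -
  have "{x + y |x y. x \<in> X \<and> y \<in> Y} \<subseteq> vec.span (insert p Y)"
  proof
    fix z assume "z \<in> {x + y |x y. x \<in> X \<and> y \<in> Y}"
    then obtain x y where z: "z = x + y" "x \<in> X" "y \<in> Y" by blast
    have "x \<in> vec.span (insert p Y)" "y \<in> vec.span (insert p Y)"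
      using z assms(3) by (auto intro: vec.span_base)
    then show "z \<in> vec.span (insert p Y)" unfolding z by (rule vec.span_add)
  qed
  then have "vec.dim {x + y |x y. x \<in> X \<and> y \<in> Y} \<le> vec.dim (insert p Y)"
    by (rule vec.dim_mono)
  also have "\<dots> \<le> Suc (vec.dim Y)" by (auto simp: vec.dim_insert)
  finally show ?thesis using vec.dim_sums_Int[OF assms(1,2)] by linarith
qed

section \<open>Extension of scalars\<close>

locale extension_field =
  fixes \<iota> :: "'q::field \<Rightarrow> 'f::field"
  assumes embedding: "field_embedding \<iota>"
begin

lemma \<iota>_one [simp]: "\<iota> 1 = 1"
  and \<iota>_add: "\<iota> (a + b) = \<iota> a + \<iota> b"
  and \<iota>_mult: "\<iota> (a * b) = \<iota> a * \<iota> b"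
  using embedding by (auto simp: field_embedding_def)

lemma \<iota>_zero [simp]: "\<iota> 0 = 0"
proof -
  have "\<iota> 0 + \<iota> 0 = \<iota> 0 + 0" unfolding \<iota>_add[symmetric] add_0_right ..
  then show ?thesis by (rule add_left_imp_eq)
qed

text \<open>The large field as a vector space over the small one; \<open>rank_q\<close> is a
  dimension in this structure.\<close>

sublocale scalars: vector_space "\<lambda>c x. \<iota> c * x"
  by unfold_locales (auto simp: algebra_simps \<iota>_add \<iota>_mult)

section \<open>Linear functionals from the large field to the small one\<close>

definition functional :: "('f \<Rightarrow> 'q) \<Rightarrow> bool" where
  "functional \<phi> \<longleftrightarrow> (\<forall>x y. \<phi> (x + y) = \<phi> x + \<phi> y) \<and> (\<forall>c x. \<phi> (\<iota> c * x) = c * \<phi> x)"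

lemma functional_add: "functional \<phi> \<Longrightarrow> \<phi> (x + y) = \<phi> x + \<phi> y"
  and functional_scale: "functional \<phi> \<Longrightarrow> \<phi> (x * \<iota> c) = \<phi> x * c"
  by (simp_all add: functional_def mult.commute[of x] mult.commute[of "\<phi> x"])

lemma functional_zero: "functional \<phi> \<Longrightarrow> \<phi> 0 = 0"
proof -
  assume \<phi>: "functional \<phi>"
  have "\<phi> 0 + \<phi> 0 = \<phi> 0 + 0" unfolding functional_add[OF \<phi>, symmetric] add_0_right ..
  then show ?thesis by (rule add_left_imp_eq)
qed

lemma functional_sum: "functional \<phi> \<Longrightarrow> \<phi> (sum f A) = (\<Sum>a\<in>A. \<phi> (f a))"
  by (induction A rule: infinite_finite_induct) (auto simp: functional_add functional_zero)

text \<open>The \<open>\<phi> b\<close> are coordinates in a basis of the large field over the small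
  one. The basis may be infinite, but finitely many elements involve only finitely many basis
  vectors.\<close>

lemma functional_expansion:
  assumes "finite X"
  obtains B \<phi> where "finite B" "\<And>b. functional (\<phi> b)"
    "\<And>x. x \<in> X \<Longrightarrow> x = (\<Sum>b\<in>B. b * \<iota> (\<phi> b x))"
proof -
  define E where "E = scalars.extend_basis {}"
  have ind: "scalars.independent E" and sp: "scalars.span E = UNIV"
    unfolding E_def
    by (simp_all add: scalars.independent_extend_basis scalars.span_extend_basis scalars.independent_empty)
  define \<phi> where "\<phi> b x = scalars.representation E x b" for b x
  define B where "B = (\<Union>x\<in>X. {b. \<phi> b x \<noteq> 0})"
  have fin: "finite {b. \<phi> b x \<noteq> 0}" for x
    by (simp add: \<phi>_def scalars.finite_representation)
  then have finB: "finite B" using assms by (simp add: B_def)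
  have "functional (\<phi> b)" for b
    unfolding functional_def \<phi>_def
    using scalars.representation_add[OF ind] scalars.representation_scale[OF ind] sp by auto
  moreover have "x = (\<Sum>b\<in>B. b * \<iota> (\<phi> b x))" if "x \<in> X" for x
  proof -
    have "x = (\<Sum>b | \<phi> b x \<noteq> 0. \<iota> (\<phi> b x) * b)"
      using scalars.sum_nonzero_representation_eq[OF ind, of x] sp by (simp add: \<phi>_def)
    also have "\<dots> = (\<Sum>b\<in>B. \<iota> (\<phi> b x) * b)"
      using finB that by (intro sum.mono_neutral_left) (auto simp: B_def)
    finally show ?thesis by (simp add: mult.commute)
  qed
  ultimately show thesis using that finB by blast
qed

lemma functional_separates:
  assumes "a \<noteq> 0"
  obtains \<phi> where "functional \<phi>" "\<phi> a \<noteq> 0"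
proof -
  obtain B \<phi> where B: "\<And>b. functional (\<phi> b)" "a = (\<Sum>b\<in>B. b * \<iota> (\<phi> b a))"
    by (rule functional_expansion[of "{a}"]) auto
  have "\<exists>b. \<phi> b a \<noteq> 0"
  proof (rule ccontr)
    assume "\<nexists>b. \<phi> b a \<noteq> 0"
    then have "(\<Sum>b\<in>B. b * \<iota> (\<phi> b a)) = 0" by simp
    then show False using B(2) assms by simp
  qed
  then show thesis using that B by blast
qed

section \<open>Extended subspaces and their description over the small field\<close>

definition lift_vec :: "'q^'n \<Rightarrow> 'f^'n" where
  "lift_vec v = (\<chi> j. \<iota> (v $ j))"

definition extend_scalars :: "('q^'n) set \<Rightarrow> ('f^'n) set" where
  "extend_scalars V = vec.span (lift_vec ` V)"

lemma subspace_extend_scalars [simp]: "vec.subspace (extend_scalars V)"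
  by (simp add: extend_scalars_def)

lemma lift_vec_extend_scalars: "v \<in> V \<Longrightarrow> lift_vec v \<in> extend_scalars V"
  by (simp add: extend_scalars_def vec.span_base)

lemma extend_scalars_mono: "U \<subseteq> V \<Longrightarrow> extend_scalars U \<subseteq> extend_scalars V"
  by (simp add: extend_scalars_def vec.span_mono image_mono)

lemma G_sub_eq: "G_sub \<iota> G V = (*v) G ` extend_scalars V"
  unfolding G_sub_def extend_scalars_def vec.linear_span_image[OF matrix_vector_mul_linear_gen, symmetric]
  by (simp add: image_image lift_vec_def)

lemma subspace_G_sub [simp]: "vec.subspace (G_sub \<iota> G V)"
  by (simp add: G_sub_def)

lemma G_sub_mono: "U \<subseteq> V \<Longrightarrow> G_sub \<iota> G U \<subseteq> G_sub \<iota> G V"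
  by (simp add: G_sub_eq image_mono extend_scalars_mono)

lemma functional_lift_span:
  assumes "functional \<phi>"
  shows "(\<chi> j. \<phi> ((\<Sum>v\<in>B. f v *s lift_vec v) $ j)) = (\<Sum>v\<in>B. \<phi> (f v) *s v)"
  using assms by (simp add: vec_eq_iff functional_sum functional_scale lift_vec_def)

text \<open>A functional applied entrywise turns the coefficients of lifted vectors into scalars of
  the small field. Conversely, expanding the entries of e in a basis writes e as a combination of
  lifts of its coordinate vectors, which lie in V.\<close>

lemma mem_extend_scalars_iff:
  assumes "vec.subspace V"
  shows "e \<in> extend_scalars V \<longleftrightarrow> (\<forall>\<phi>. functional \<phi> \<longrightarrow> (\<chi> j. \<phi> (e $ j)) \<in> V)"
proof (intro iffI allI impI)
  fix \<phi> assume \<phi>: "functional \<phi>" and e: "e \<in> extend_scalars V"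
  show "(\<chi> j. \<phi> (e $ j)) \<in> V"
    using e unfolding extend_scalars_def
  proof (induction rule: vec.span_induct_alt)
    case base
    have "(\<chi> j. \<phi> ((0::'f^'a) $ j)) = 0" using \<phi> by (simp add: vec_eq_iff functional_zero)
    then show ?case using assms by (simp add: vec.subspace_0)
  next
    case (step c x y)
    then obtain v where v: "v \<in> V" "x = lift_vec v" by auto
    have "(\<chi> j. \<phi> ((c *s x + y) $ j)) = \<phi> c *s v + (\<chi> j. \<phi> (y $ j))"
      using \<phi> by (simp add: vec_eq_iff v functional_add functional_scale lift_vec_def)
    then show ?case using step v assms by (simp add: vec.subspace_add vec.subspace_scale)
  qed
next
  assume e: "\<forall>\<phi>. functional \<phi> \<longrightarrow> (\<chi> j. \<phi> (e $ j)) \<in> V"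
  obtain B \<phi> where B: "finite B" "\<And>b. functional (\<phi> b)"
    "\<And>x. x \<in> range (($) e) \<Longrightarrow> x = (\<Sum>b\<in>B. b * \<iota> (\<phi> b x))"
    by (rule functional_expansion[of "range (($) e)"]) auto
  have "e $ j = (\<Sum>b\<in>B. b * \<iota> (\<phi> b (e $ j)))" for j using B(3) by blast
  then have "e = (\<Sum>b\<in>B. b *s lift_vec (\<chi> j. \<phi> b (e $ j)))"
    by (simp add: vec_eq_iff lift_vec_def)
  also have "\<dots> \<in> extend_scalars V"
    using e B by (intro vec.subspace_sum vec.subspace_scale lift_vec_extend_scalars) auto
  finally show "e \<in> extend_scalars V" .
qed

text \<open>The criterion by functionals is a conjunction over i, so extension of scalars commutes
  with intersection.\<close>

lemma extend_scalars_INT: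
  assumes "\<And>i. i \<in> I \<Longrightarrow> vec.subspace (V i)" "\<And>i. i \<in> I \<Longrightarrow> e \<in> extend_scalars (V i)"
  shows "e \<in> extend_scalars (\<Inter>i\<in>I. V i)"
proof -
  have "vec.subspace (\<Inter>i\<in>I. V i)" using assms(1) by (blast intro: vec.subspace_Inter)
  moreover have "(\<chi> j. \<phi> (e $ j)) \<in> V i" if "functional \<phi>" "i \<in> I" for \<phi> i
    using mem_extend_scalars_iff[OF assms(1)[OF that(2)]] assms(2)[OF that(2)] that(1) by blast
  ultimately show ?thesis by (blast intro: mem_extend_scalars_iff[THEN iffD2])
qed

lemma extend_scalars_span: "extend_scalars (vec.span B) = vec.span (lift_vec ` B)"
proof
  have "lift_vec v \<in> vec.span (lift_vec ` B)" if "v \<in> vec.span B" for v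
    using that
  proof (induction rule: vec.span_induct_alt)
    case base
    have "lift_vec 0 = 0" by (simp add: vec_eq_iff lift_vec_def)
    then show ?case using vec.span_zero by metis
  next
    case (step c x y)
    have "lift_vec (c *s x + y) = \<iota> c *s lift_vec x + lift_vec y"
      by (simp add: vec_eq_iff lift_vec_def \<iota>_add \<iota>_mult)
    then show ?case using step by (simp add: vec.span_add vec.span_scale vec.span_base)
  qed
  then show "extend_scalars (vec.span B) \<subseteq> vec.span (lift_vec ` B)"
    unfolding extend_scalars_def by (intro vec.span_minimal) auto
  show "vec.span (lift_vec ` B) \<subseteq> extend_scalars (vec.span B)"
    unfolding extend_scalars_def by (intro vec.span_mono image_mono vec.span_superset)
qed

lemma inj_lift_vec: "inj lift_vec"
proof (rule injI)
  fix u v assume uv: "lift_vec u = (lift_vec v :: 'f^'a)"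
  \<comment> \<open>A functional that is nonzero at 1 recovers each entry from its lift up to one
    fixed nonzero factor.\<close>
  obtain \<phi> where \<phi>: "functional \<phi>" "\<phi> 1 \<noteq> 0" using functional_separates[of 1] by auto
  have "\<phi> 1 * u $ j = \<phi> 1 * v $ j" for j
  proof -
    have "\<iota> (u $ j) = \<iota> (v $ j)" using uv by (simp add: lift_vec_def vec_eq_iff)
    then show ?thesis
      using functional_scale[OF \<phi>(1), of 1 "u $ j"] functional_scale[OF \<phi>(1), of 1 "v $ j"]
      by simp
  qed
  then show "u = v" using \<phi> by (simp add: vec_eq_iff)
qed

text \<open>A functional maps a relation between the lifts to one between the original vectors, and
  functionals detect nonzero coefficients.\<close>

lemma independent_lift_vec:
  assumes "vec.independent B"
  shows "vec.independent (lift_vec ` B)"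
proof (rule vec.independent_if_scalars_zero)
  have fin: "finite B" using assms vec.finiteI_independent by blast
  then show "finite (lift_vec ` B)" by simp
  fix f x assume s: "(\<Sum>x\<in>lift_vec ` B. f x *s x) = 0" and x: "x \<in> lift_vec ` B"
  then obtain b where b: "b \<in> B" "x = lift_vec b" by auto
  have s': "(\<Sum>v\<in>B. f (lift_vec v) *s lift_vec v) = 0"
    using s unfolding sum.reindex[OF inj_on_subset[OF inj_lift_vec subset_UNIV]] o_def .
  have "\<phi> (f x) = 0" if \<phi>: "functional \<phi>" for \<phi>
  proof -
    have "(\<Sum>v\<in>B. \<phi> (f (lift_vec v)) *s v)
        = (\<chi> j. \<phi> ((\<Sum>v\<in>B. f (lift_vec v) *s lift_vec v) $ j))"
      by (rule functional_lift_span[OF \<phi>, symmetric])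
    also have "\<dots> = 0" unfolding s' by (simp add: vec_eq_iff functional_zero[OF \<phi>])
    finally show ?thesis
      using vec.independentD[OF assms fin order_refl, of "\<lambda>v. \<phi> (f (lift_vec v))" b] b by simp
  qed
  then show "f x = 0" using functional_separates by blast
qed

lemma dim_extend_scalars:
  assumes "vec.subspace V"
  shows "vec.dim (extend_scalars V) = vec.dim V"
proof -
  obtain B where B: "B \<subseteq> V" "vec.independent B" "V \<subseteq> vec.span B" "card B = vec.dim V"
    using vec.basis_exists by blast
  then have "V = vec.span B" using assms vec.span_subspace by blast
  then have "extend_scalars V = vec.span (lift_vec ` B)" using extend_scalars_span by metis
  then have "vec.dim (extend_scalars V) = card (lift_vec ` B)"
    using vec.dim_span_eq_card_independent[OF independent_lift_vec[OF B(2)]] by simp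
  also have "\<dots> = card B" by (intro card_image inj_on_subset[OF inj_lift_vec]) auto
  finally show ?thesis using B by simp
qed

section \<open>Rank as the least dimension of a supporting subspace\<close>

text \<open>All entries of e are combinations, over the small field, of its coefficients along a
  lifted basis of V.\<close>

lemma rank_q_le_dim:
  assumes "vec.subspace V" "e \<in> extend_scalars V"
  shows "rank_q \<iota> e \<le> vec.dim V"
proof -
  obtain B where B: "B \<subseteq> V" "vec.independent B" "V \<subseteq> vec.span B" "card B = vec.dim V"
    using vec.basis_exists by blast
  have fin: "finite B" using B vec.finiteI_independent by blast
  have "V = vec.span B" using assms(1) B vec.span_subspace by blast
  then have "e \<in> vec.span (lift_vec ` B)" using assms extend_scalars_span by metis
  then obtain u where "e = (\<Sum>v\<in>lift_vec ` B. u v *s v)"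
    unfolding vec.span_finite[OF finite_imageI[OF fin]] by blast
  then have e: "e = (\<Sum>v\<in>B. u (lift_vec v) *s lift_vec v)"
    unfolding sum.reindex[OF inj_on_subset[OF inj_lift_vec subset_UNIV]] o_def .
  have "e $ j \<in> scalars.span ((\<lambda>v. u (lift_vec v)) ` B)" for j
  proof -
    have "e $ j = (\<Sum>v\<in>B. \<iota> (v $ j) * u (lift_vec v))"
      unfolding arg_cong[OF e, of "\<lambda>x. x $ j"] by (simp add: lift_vec_def mult.commute)
    also have "\<dots> \<in> scalars.span ((\<lambda>v. u (lift_vec v)) ` B)"
      by (intro scalars.span_sum scalars.span_scale scalars.span_base) auto
    finally show ?thesis .
  qed
  then have "rank_q \<iota> e \<le> card ((\<lambda>v. u (lift_vec v)) ` B)"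
    unfolding rank_q_def using fin by (intro scalars.dim_le_card) auto
  also have "\<dots> \<le> card B" using fin by (rule card_image_le)
  finally show ?thesis using B by simp
qed

text \<open>The coordinates of the entries of e in a basis of their span, collected by basis vector,
  generate such a V.\<close>

lemma rank_q_attained:
  obtains V where "vec.subspace V" "e \<in> extend_scalars V" "vec.dim V \<le> rank_q \<iota> e"
proof -
  obtain B where B: "B \<subseteq> range (($) e)" "range (($) e) \<subseteq> scalars.span B" "card B = rank_q \<iota> e"
    unfolding rank_q_def by (rule scalars.basis_exists[of "range (($) e)"])
  have fin: "finite B" using B(1) by (rule finite_subset) simp
  have "\<exists>c. e $ j = (\<Sum>b\<in>B. \<iota> (c b) * b)" for j
  proof -
    have "e $ j \<in> range (\<lambda>u. \<Sum>b\<in>B. \<iota> (u b) * b)"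
      using B(2) unfolding scalars.span_finite[OF fin] by blast
    then show ?thesis by blast
  qed
  then obtain c where c: "\<And>j. e $ j = (\<Sum>b\<in>B. \<iota> (c j b) * b)" by metis
  define V where "V = vec.span ((\<lambda>b. \<chi> j. c j b) ` B)"
  have "e = (\<Sum>b\<in>B. b *s lift_vec (\<chi> j. c j b))"
    unfolding vec_eq_iff
  proof
    fix j show "e $ j = (\<Sum>b\<in>B. b *s lift_vec (\<chi> j. c j b)) $ j"
      unfolding c[of j] by (simp add: lift_vec_def mult.commute)
  qed
  also have "\<dots> \<in> extend_scalars V"
    by (intro vec.subspace_sum vec.subspace_scale lift_vec_extend_scalars)
       (auto simp: V_def vec.span_base)
  finally have "e \<in> extend_scalars V" .
  moreover have "vec.dim V \<le> card ((\<lambda>b. \<chi> j. c j b) ` B)"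
    unfolding V_def using fin by (intro vec.dim_le_card) auto
  then have "vec.dim V \<le> rank_q \<iota> e"
    using card_image_le[OF fin, of "\<lambda>b. \<chi> j. c j b"] B(3) by linarith
  ultimately show thesis using that[of V] by (simp add: V_def)
qed

section \<open>Cutting a subspace by a hyperplane\<close>

text \<open>A suitable functional sends e to a nonzero w in V. Dropping w from a basis of V through
  w leaves H without w, so the same functional shows that e is outside the extension of H.\<close>

lemma exists_hyperplane_avoiding:
  assumes "vec.subspace V" "e \<in> extend_scalars V" "e \<noteq> 0"
  obtains H v where "vec.subspace H" "H \<subseteq> V" "V \<subseteq> vec.span (insert v H)" "e \<notin> extend_scalars H"
proof -
  obtain j where "e $ j \<noteq> 0" using assms(3) by (auto simp: vec_eq_iff)
  then obtain \<phi> where \<phi>: "functional \<phi>" "\<phi> (e $ j) \<noteq> 0" using functional_separates by blast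
  define w where "w = (\<chi> j. \<phi> (e $ j))"
  have w: "w \<in> V" "w \<noteq> 0"
  proof -
    show "w \<in> V"
      using assms(2) \<phi>(1) unfolding w_def mem_extend_scalars_iff[OF assms(1)] by blast
    have "w $ j \<noteq> 0" using \<phi>(2) by (simp add: w_def)
    then show "w \<noteq> 0" by auto
  qed
  then obtain B where B: "{w} \<subseteq> B" "B \<subseteq> V" "vec.independent B" "V \<subseteq> vec.span B"
    using vec.maximal_independent_subset_extend[of "{w}" V] by auto
  define H where "H = vec.span (B - {w})"
  have "w \<notin> H" using B unfolding H_def vec.dependent_def by auto
  then have "e \<notin> extend_scalars H"
    using \<phi>(1) unfolding w_def H_def mem_extend_scalars_iff[OF vec.subspace_span] by blast
  moreover have "H \<subseteq> V" unfolding H_def using B assms(1) by (intro vec.span_minimal) auto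
  moreover have "V \<subseteq> vec.span (insert w H)"
  proof -
    have "B \<subseteq> insert w H" using vec.span_superset[of "B - {w}"] by (auto simp: H_def)
    then show ?thesis using B(4) vec.span_mono by blast
  qed
  ultimately show thesis using that[of H w] by (simp add: H_def)
qed

text \<open>Passing from H to V adds at most one generator, the image of v.\<close>

lemma dim_Int_G_sub_hyperplane:
  fixes V :: "('q^'n) set" and G :: "'f^'n^'k"
  assumes "vec.subspace T" "V \<subseteq> vec.span (insert v H)" "H \<subseteq> V"
  shows "vec.dim (T \<inter> G_sub \<iota> G V) \<le> Suc (vec.dim (T \<inter> G_sub \<iota> G H))"
proof -
  have "extend_scalars V \<subseteq> extend_scalars (vec.span (insert v H))"
    by (rule extend_scalars_mono[OF assms(2)])
  also have "\<dots> = vec.span (insert (lift_vec v) (lift_vec ` H))" by (simp add: extend_scalars_span)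
  finally have "G_sub \<iota> G V \<subseteq> vec.span ((*v) G ` insert (lift_vec v) (lift_vec ` H))"
    unfolding G_sub_eq vec.linear_span_image[OF matrix_vector_mul_linear_gen] by (rule image_mono)
  also have "\<dots> \<subseteq> vec.span (insert (G *v lift_vec v) (G_sub \<iota> G H))"
    by (intro vec.span_mono) (auto simp: G_sub_eq intro: lift_vec_extend_scalars)
  finally have "vec.dim (T \<inter> G_sub \<iota> G V) \<le> Suc (vec.dim ((T \<inter> G_sub \<iota> G V) \<inter> G_sub \<iota> G H))"
    using assms(1) by (intro dim_le_Suc_Int) (auto intro: vec.subspace_inter)
  also have "(T \<inter> G_sub \<iota> G V) \<inter> G_sub \<iota> G H = T \<inter> G_sub \<iota> G H"
    using G_sub_mono[OF assms(3), of G] by auto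
  finally show ?thesis .
qed

section \<open>Injectivity on small subspaces, labellings and blocks\<close>

text \<open>By the two rank lemmas, this says that the kernel of \<open>G\<close> has no nonzero
  vector of rank at most k.\<close>

definition injective_up_to_k :: "'f^'n^'k \<Rightarrow> bool" where
  "injective_up_to_k G \<longleftrightarrow> (\<forall>V e. vec.subspace V \<longrightarrow> vec.dim V \<le> CARD('k) \<longrightarrow>
     e \<in> extend_scalars V \<longrightarrow> G *v e = 0 \<longrightarrow> e = 0)"

lemma injective_up_to_kD:
  fixes G :: "'f^'n^'k"
  assumes "injective_up_to_k G" "vec.subspace V" "vec.dim V \<le> CARD('k)"
    "e \<in> extend_scalars V" "e' \<in> extend_scalars V" "G *v e = G *v e'"
  shows "e = e'"
proof -
  have "e - e' \<in> extend_scalars V" using assms by (simp add: vec.subspace_diff)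
  moreover have "G *v (e - e') = 0" using assms(6) by (simp add: matrix_vector_mult_diff_distrib)
  ultimately show ?thesis using assms(1-3) unfolding injective_up_to_k_def by fastforce
qed

text \<open>Extension of scalars keeps the dimension, so injectivity can be read off dimensions, the
  form in which the MRD condition supplies it.\<close>

lemma injective_up_to_k_iff_dim:
  fixes G :: "'f^'n^'k"
  shows "injective_up_to_k G \<longleftrightarrow>
    (\<forall>V. vec.subspace V \<longrightarrow> vec.dim V \<le> CARD('k) \<longrightarrow> vec.dim (G_sub \<iota> G V) = vec.dim V)"
proof (intro iffI allI impI)
  fix V :: "('q^'n) set" assume *: "injective_up_to_k G" "vec.subspace V" "vec.dim V \<le> CARD('k)"
  have "inj_on ((*v) G) (vec.span (extend_scalars V))"
    unfolding vec.span_eq_iff[THEN iffD2, OF subspace_extend_scalars]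
    using injective_up_to_kD[OF *] by (intro inj_onI)
  then show "vec.dim (G_sub \<iota> G V) = vec.dim V"
    using dim_extend_scalars[OF *(2)]
    by (simp add: G_sub_eq vec.dim_image_eq[OF matrix_vector_mul_linear_gen])
next
  assume *: "\<forall>V. vec.subspace V \<longrightarrow> vec.dim V \<le> CARD('k) \<longrightarrow> vec.dim (G_sub \<iota> G V) = vec.dim V"
  show "injective_up_to_k G"
    unfolding injective_up_to_k_def
  proof (intro allI impI)
    fix V :: "('q^'n) set" and e assume V: "vec.subspace V" "vec.dim V \<le> CARD('k)" "e \<in> extend_scalars V" "G *v e = 0"
    then have "vec.dim (G_sub \<iota> G V) = vec.dim V" using * by blast
    then have "vec.dim (extend_scalars V) \<le> vec.dim ((*v) G ` extend_scalars V)"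
      using dim_extend_scalars[OF V(1)] G_sub_eq[of G V] by simp
    then show "e = 0" using image_dim_eq_imp_zero[of "extend_scalars V" G e] V by simp
  qed
qed

text \<open>These are the U_b. A label that is not attained has the whole space as its block, so
  sums run over attained labels only.\<close>

abbreviation block :: "('i \<Rightarrow> 'b) \<Rightarrow> 'i set \<Rightarrow> ('i \<Rightarrow> ('q^'n) set) \<Rightarrow> 'b \<Rightarrow> ('q^'n) set" where
  "block c I V b \<equiv> (\<Inter>i\<in>{i \<in> I. c i = b}. V i)"

lemma block_subspace: "(\<And>i. i \<in> I \<Longrightarrow> vec.subspace (V i)) \<Longrightarrow> vec.subspace (block c I V b)"
  by (blast intro: vec.subspace_Inter)

lemma dim_block_le:
  assumes "\<And>i. i \<in> I \<Longrightarrow> vec.dim (V i) \<le> m" "b \<in> c ` I"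
  shows "vec.dim (block c I V b) \<le> m"
proof -
  obtain i where i: "i \<in> I" "b = c i" using assms(2) by auto
  then have "block c I V b \<subseteq> V i" by auto
  then show ?thesis using assms(1)[OF i(1)] vec.dim_subset order_trans by blast
qed

lemma INT_G_sub_block_subset:
  "(\<Inter>b\<in>c ` I. G_sub \<iota> G (block c I V b)) \<subseteq> (\<Inter>i\<in>I. G_sub \<iota> G (V i))"
proof (intro INT_greatest subsetI)
  fix i s assume "i \<in> I" "s \<in> (\<Inter>b\<in>c ` I. G_sub \<iota> G (block c I V b))"
  moreover from \<open>i \<in> I\<close> have "block c I V (c i) \<subseteq> V i" by auto
  ultimately show "s \<in> G_sub \<iota> G (V i)" using G_sub_mono by blast
qed

text \<open>An attained block lies in some \<open>V i\<close>, so \<open>G\<close> preserves its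
  dimension; the rest is subadditivity of codimension.\<close>

lemma sum_dim_block_le:
  fixes G :: "'f^'n^'k"
  assumes "injective_up_to_k G" "finite I" "I \<noteq> {}"
    "\<And>i. i \<in> I \<Longrightarrow> vec.subspace (V i)" "\<And>i. i \<in> I \<Longrightarrow> vec.dim (V i) \<le> CARD('k)"
  shows "(\<Sum>b\<in>c ` I. vec.dim (block c I V b))
    \<le> vec.dim (\<Inter>b\<in>c ` I. G_sub \<iota> G (block c I V b)) + (card (c ` I) - 1) * CARD('k)"
proof -
  have "vec.dim (G_sub \<iota> G (block c I V b)) = vec.dim (block c I V b)" if "b \<in> c ` I" for b
  proof -
    have "vec.subspace (block c I V b)" using assms(4) by (rule block_subspace)
    moreover have "vec.dim (block c I V b) \<le> CARD('k)" using assms(5) that by (rule dim_block_le)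
    ultimately show ?thesis using assms(1) unfolding injective_up_to_k_iff_dim by blast
  qed
  then show ?thesis
    using dim_INT_lower[of "c ` I" "\<lambda>b. G_sub \<iota> G (block c I V b)"] assms by simp
qed

end

section \<open>Partial derivatives of rational functions\<close>

text \<open>Subtraction of exponents is truncated; where \<open>x\<close> has exponent 0, the factor
  \<open>of_nat 0\<close> removes the term.\<close>

definition poly_deriv :: "nat \<Rightarrow> ((nat \<Rightarrow>\<^sub>0 nat) \<Rightarrow>\<^sub>0 'q::comm_ring_1) \<Rightarrow> ((nat \<Rightarrow>\<^sub>0 nat) \<Rightarrow>\<^sub>0 'q)" where
  "poly_deriv x p = (\<Sum>m\<in>Poly_Mapping.keys p.
     Poly_Mapping.single (m - Poly_Mapping.single x 1)
       (of_nat (Poly_Mapping.lookup m x) * Poly_Mapping.lookup p m))"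

lemma poly_deriv_superset:
  assumes "finite A" "Poly_Mapping.keys p \<subseteq> A"
  shows "poly_deriv x p = (\<Sum>m\<in>A. Poly_Mapping.single (m - Poly_Mapping.single x 1)
       (of_nat (Poly_Mapping.lookup m x) * Poly_Mapping.lookup p m))"
  unfolding poly_deriv_def
  using assms by (intro sum.mono_neutral_left) (auto simp: in_keys_iff)

lemma poly_deriv_add: "poly_deriv x (p + q) = poly_deriv x p + poly_deriv x q"
proof -
  let ?A = "Poly_Mapping.keys p \<union> Poly_Mapping.keys q"
  have "Poly_Mapping.keys (p + q) \<subseteq> ?A" by (rule Poly_Mapping.keys_add)
  then show ?thesis
    by (simp add: poly_deriv_superset[of ?A] lookup_add distrib_left single_add sum.distrib)
qed

lemma poly_deriv_single:
  "poly_deriv x (Poly_Mapping.single m c)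
     = Poly_Mapping.single (m - Poly_Mapping.single x 1) (of_nat (Poly_Mapping.lookup m x) * c)"
  by (subst poly_deriv_superset[of "{m}"]) auto

lemma poly_deriv_zero: "poly_deriv x 0 = 0"
  by (simp add: poly_deriv_def)

lemma poly_deriv_sum: "poly_deriv x (sum f A) = (\<Sum>a\<in>A. poly_deriv x (f a))"
  by (induction A rule: infinite_finite_induct) (auto simp: poly_deriv_zero poly_deriv_add)

lemma poly_mapping_sum_singles:
  "p = (\<Sum>m\<in>Poly_Mapping.keys p. Poly_Mapping.single m (Poly_Mapping.lookup p m))"
proof (rule poly_mapping_eqI)
  fix k
  have "(\<Sum>m\<in>Poly_Mapping.keys p. Poly_Mapping.lookup (Poly_Mapping.single m (Poly_Mapping.lookup p m)) k)
    = (\<Sum>m\<in>Poly_Mapping.keys p. if m = k then Poly_Mapping.lookup p k else 0)"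
    by (intro sum.cong) (auto simp: lookup_single when_def)
  also have "\<dots> = Poly_Mapping.lookup p k" by (simp add: in_keys_iff)
  finally show "Poly_Mapping.lookup p k = Poly_Mapping.lookup
     (\<Sum>m\<in>Poly_Mapping.keys p. Poly_Mapping.single m (Poly_Mapping.lookup p m)) k"
    by (simp add: lookup_sum)
qed

lemma poly_deriv_mult_single:
  "poly_deriv x (Poly_Mapping.single m c * Poly_Mapping.single m' c')
    = poly_deriv x (Poly_Mapping.single m c) * Poly_Mapping.single m' c'
      + Poly_Mapping.single m c * poly_deriv x (Poly_Mapping.single m' c')"
proof -
  let ?X = "Poly_Mapping.single x (1::nat)"
  \<comment> \<open>This can fail when \<open>x\<close> does not occur in \<open>m\<close>, but then
    the coefficient is zero; hence the case splits below.\<close>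
  have exp: "m + m' - ?X = (m - ?X) + m'" if "Poly_Mapping.lookup m x \<noteq> 0" for m m' :: "nat \<Rightarrow>\<^sub>0 nat"
    using that by (intro poly_mapping_eqI) (auto simp: lookup_add lookup_minus lookup_single when_def)
  have e1: "Poly_Mapping.single (m + m' - ?X) (of_nat (Poly_Mapping.lookup m x) * (c * c'))
      = Poly_Mapping.single ((m - ?X) + m') (of_nat (Poly_Mapping.lookup m x) * (c * c'))"
    using exp[of m m'] by (cases "Poly_Mapping.lookup m x = 0") auto
  have e2: "Poly_Mapping.single (m + m' - ?X) (of_nat (Poly_Mapping.lookup m' x) * (c * c'))
      = Poly_Mapping.single (m + (m' - ?X)) (of_nat (Poly_Mapping.lookup m' x) * (c * c'))"
    using exp[of m' m] by (cases "Poly_Mapping.lookup m' x = 0") (auto simp: add.commute)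
  show ?thesis
    using e1 e2
    by (simp add: mult_single poly_deriv_single lookup_add distrib_right single_add mult.assoc
        mult.left_commute[of c])
qed

lemma poly_deriv_mult: "poly_deriv x (p * q) = poly_deriv x p * q + p * poly_deriv x q"
proof -
  let ?s = "\<lambda>p m. Poly_Mapping.single m (Poly_Mapping.lookup p m)"
  let ?P = "Poly_Mapping.keys p" and ?Q = "Poly_Mapping.keys q"
  have "poly_deriv x ((\<Sum>m\<in>?P. ?s p m) * (\<Sum>m\<in>?Q. ?s q m))
    = poly_deriv x (\<Sum>m\<in>?P. ?s p m) * (\<Sum>m\<in>?Q. ?s q m)
      + (\<Sum>m\<in>?P. ?s p m) * poly_deriv x (\<Sum>m\<in>?Q. ?s q m)"
    by (simp add: poly_deriv_sum sum_product poly_deriv_mult_single sum.distrib)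
  then show ?thesis by (simp add: poly_mapping_sum_singles[symmetric])
qed

text \<open>The formal derivative of polynomials extends to fractions by the quotient rule.\<close>

lemma exists_partial_derivative:
  obtains D :: "'q::field ratfun \<Rightarrow> 'q ratfun" where
    "\<And>a b. D (a + b) = D a + D b" "\<And>a b. D (a * b) = D a * b + a * D b"
    "\<And>c. D (ratfun_const c) = 0" "\<And>y. D (ratfun_var y) = (if y = x then 1 else 0)"
proof -
  define d where "d = (poly_deriv x :: _ \<Rightarrow> ((nat \<Rightarrow>\<^sub>0 nat) \<Rightarrow>\<^sub>0 'q))"
  have d_add: "d (p + q) = d p + d q" and d_mult: "d (p * q) = d p * q + p * d q" for p q
    by (simp_all add: d_def poly_deriv_add poly_deriv_mult)
  define rep :: "'q ratfun \<Rightarrow> _" where "rep r = (SOME p. r = Fract (fst p) (snd p) \<and> snd p \<noteq> 0)" for r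
  have rep: "r = Fract (fst (rep r)) (snd (rep r)) \<and> snd (rep r) \<noteq> 0" for r
    unfolding rep_def by (rule someI_ex) (metis Fract_cases fst_conv snd_conv)
  define D where "D r = (case rep r of (a, b) \<Rightarrow> Fract (d a * b - a * d b) (b * b))" for r
  \<comment> \<open>Independence of the representative: differentiating the cross-multiplied
    equality \<open>e\<close> gives \<open>e'\<close>, and the two together identify both
    quotient-rule values.\<close>
  have D: "D (Fract a b) = Fract (d a * b - a * d b) (b * b)" if b: "b \<noteq> 0" for a b
  proof -
    obtain a' b' where r: "rep (Fract a b) = (a', b')" by force
    with rep[of "Fract a b"] have b': "b' \<noteq> 0" "Fract a b = Fract a' b'" by auto
    with b have e: "a * b' = a' * b" by (simp add: eq_fract)
    then have "d (a * b') = d (a' * b)" by simp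
    then have e': "d a * b' + a * d b' = d a' * b + a' * d b" by (simp add: d_mult)
    have "(d a' * b' - a' * d b') * (b * b) = (d a * b - a * d b) * (b' * b')"
      using e e' by algebra
    then show ?thesis using b b' by (simp add: D_def r eq_fract)
  qed
  have add: "D (r + s) = D r + D s" for r s
    by (cases r; cases s) (simp add: D eq_fract d_add d_mult algebra_simps)
  have mult: "D (r * s) = D r * s + r * D s" for r s
    by (cases r; cases s) (simp add: D eq_fract d_add d_mult algebra_simps)
  have d1: "d 1 = 0"
    by (simp add: d_def poly_deriv_single flip: single_one)
  have c: "D (ratfun_const c) = 0" for c
    by (simp add: ratfun_const_def D d1) (simp add: d_def poly_deriv_single fract_collapse)
  have v: "D (ratfun_var y) = (if y = x then 1 else 0)" for y
    by (simp add: ratfun_var_def D d1)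
       (simp add: d_def poly_deriv_single fract_collapse lookup_single when_def)
  show thesis by (rule that[OF add mult c v])
qed

lemma field_embedding_ratfun_const: "field_embedding (ratfun_const :: 'q::field \<Rightarrow> 'q ratfun)"
  by (simp add: field_embedding_def ratfun_const_def mult_single single_add fract_collapse)

section \<open>Intersections for the generic matrix\<close>

lemma dual_code_D: "\<eta> \<in> dual_code X \<Longrightarrow> x \<in> X \<Longrightarrow> (\<Sum>i\<in>UNIV. \<eta> $ i * x $ i) = 0"
  by (simp add: dual_code_def)

text \<open>\<open>D a j\<close> stands for the partial derivative by the (a, j) entry. Genericity
  of \<open>W\<close> enters only through these derivations.\<close>

locale generic_code = extension_field \<iota> for \<iota> :: "'q::field \<Rightarrow> 'f::field" +
  fixes W :: "'f^'n^'k" and D :: "'k \<Rightarrow> 'n \<Rightarrow> 'f \<Rightarrow> 'f"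
  assumes D_add: "D a j (x + y) = D a j x + D a j y"
    and D_mult: "D a j (x * y) = D a j x * y + x * D a j y"
    and D_const: "D a j (\<iota> c) = 0"
    and D_entry: "D a j (W $ i $ l) = (if i = a \<and> l = j then 1 else 0)"
begin

lemma D_zero: "D a j 0 = 0"
  using D_const[of a j 0] by simp

lemma D_sum: "D a j (sum f A) = (\<Sum>x\<in>A. D a j (f x))"
  by (induction A rule: infinite_finite_induct) (auto simp: D_zero D_add)

text \<open>Lifted vectors are constants, so only the coefficients get differentiated.\<close>

lemma D_extend_scalars:
  fixes e :: "'f^'m"
  assumes "e \<in> extend_scalars V"
  shows "(\<chi> l. D a j (e $ l)) \<in> extend_scalars V"
  using assms unfolding extend_scalars_def
proof (induction rule: vec.span_induct_alt)
  case base
  have "(\<chi> l. D a j ((0::'f^'m) $ l)) = 0" by (simp add: vec_eq_iff D_zero)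
  then show ?case by (simp only: vec.span_zero)
next
  case (step c x y)
  then obtain v where v: "v \<in> V" "x = lift_vec v" by auto
  have "(\<chi> l. D a j ((c *s x + y) $ l)) = D a j c *s x + (\<chi> l. D a j (y $ l))"
    by (simp add: vec_eq_iff v lift_vec_def D_add D_mult D_const)
  then show ?case using step by (simp add: vec.span_add vec.span_scale vec.span_base)
qed

text \<open>Differentiating s = W e with respect to the (a, j) entry of W gives e_j times the a-th unit vector
  plus W applied to the derivative of e, and the latter stays in the extension of scalars of V. So every
  annihilator of W_V is a joint eigenvector of the operators sending an annihilator to its pairings with the
  derivatives of s, and the joint eigenvalue is e.\<close>
lemma annihilator_derivative:
  assumes "\<eta> \<in> dual_code (G_sub \<iota> W V)" "e \<in> extend_scalars V"
  shows "(\<Sum>i\<in>UNIV. \<eta> $ i * D a j ((W *v e) $ i)) = e $ j * \<eta> $ a"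
proof -
  define e' where "e' = (\<chi> l. D a j (e $ l))"
  have "D a j ((W *v e) $ i) = (if i = a then e $ j else 0) + (W *v e') $ i" for i
  proof -
    have "D a j ((W *v e) $ i) = (\<Sum>l\<in>UNIV. D a j (W $ i $ l) * e $ l + W $ i $ l * D a j (e $ l))"
      by (simp add: matrix_vector_mult_def D_sum D_mult)
    also have "\<dots> = (\<Sum>l\<in>UNIV. D a j (W $ i $ l) * e $ l) + (W *v e') $ i"
      by (simp add: sum.distrib matrix_vector_mult_def e'_def)
    also have "(\<Sum>l\<in>UNIV. D a j (W $ i $ l) * e $ l) = (\<Sum>l\<in>UNIV. if l = j then (if i = a then e $ j else 0) else 0)"
      by (intro sum.cong) (auto simp: D_entry)
    finally show ?thesis by simp
  qed
  then have "(\<Sum>i\<in>UNIV. \<eta> $ i * D a j ((W *v e) $ i))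
    = (\<Sum>i\<in>UNIV. if i = a then e $ j * \<eta> $ a else 0) + (\<Sum>i\<in>UNIV. \<eta> $ i * (W *v e') $ i)"
    unfolding sum.distrib[symmetric] by (intro sum.cong) (auto simp: distrib_left mult.commute)
  also have "W *v e' \<in> G_sub \<iota> W V"
    using D_extend_scalars[OF assms(2)] by (simp add: G_sub_eq e'_def)
  then have "(\<Sum>i\<in>UNIV. \<eta> $ i * (W *v e') $ i) = 0" by (rule dual_code_D[OF assms(1)])
  finally show ?thesis by simp
qed

text \<open>If W e = 0, the derivatives of W e vanish, so a nonzero entry of e kills every
  annihilator. Then W_V is the whole space, of dimension at least dim V, which leaves no room for a
  kernel.\<close>

lemma injective_up_to_k_generic: "injective_up_to_k W"
  unfolding injective_up_to_k_def
proof (intro allI impI)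
  fix V e assume V: "vec.subspace V" "vec.dim V \<le> CARD('k)" "e \<in> extend_scalars V" "W *v e = 0"
  show "e = 0"
  proof (rule ccontr)
    assume "e \<noteq> 0"
    then obtain j where j: "e $ j \<noteq> 0" by (auto simp: vec_eq_iff)
    have "\<eta> = 0" if "\<eta> \<in> dual_code (G_sub \<iota> W V)" for \<eta>
    proof -
      have "e $ j * \<eta> $ a = 0" for a
        using annihilator_derivative[OF that V(3), of a j] V(4) by (simp add: D_zero)
      then show ?thesis using j by (simp add: vec_eq_iff)
    qed
    then have "dual_code (G_sub \<iota> W V) \<subseteq> {0}" by blast
    then have "vec.dim (dual_code (G_sub \<iota> W V)) = 0" by (simp only: vec.dim_eq_0)
    then have "vec.dim (G_sub \<iota> W V) = CARD('k)" using dim_dual_code[of "G_sub \<iota> W V"] by linarith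
    then have "vec.dim (extend_scalars V) \<le> vec.dim ((*v) W ` extend_scalars V)"
      using V(2) dim_extend_scalars[OF V(1)] G_sub_eq[of W V] by simp
    then show False using image_dim_eq_imp_zero[of "extend_scalars V" W e] V \<open>e \<noteq> 0\<close> by simp
  qed
qed

text \<open>A label is the map sending a point of the intersection to its preimage in the i-th extended subspace.
  Different labels are different joint eigenvalues, so the annihilators belonging to different labels are
  independent; all of them annihilate the intersection.\<close>
lemma dim_INT_generic_le:
  assumes "finite I" "I \<noteq> {}"
    "\<And>i. i \<in> I \<Longrightarrow> vec.subspace (V i)" "\<And>i. i \<in> I \<Longrightarrow> vec.dim (V i) \<le> CARD('k)"
  obtains c :: "'i \<Rightarrow> 'f^'k \<Rightarrow> 'f^'n" where
    "vec.dim (\<Inter>i\<in>I. G_sub \<iota> W (V i)) + (card (c ` I) - 1) * CARD('k)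
      \<le> (\<Sum>b\<in>c ` I. vec.dim (block c I V b))"
proof -
  define S where "S = (\<Inter>i\<in>I. G_sub \<iota> W (V i))"
  have "\<forall>i\<in>I. \<forall>s\<in>S. \<exists>e. e \<in> extend_scalars (V i) \<and> W *v e = s"
    unfolding S_def G_sub_eq by blast
  then obtain E where E: "\<And>i s. i \<in> I \<Longrightarrow> s \<in> S \<Longrightarrow> E i s \<in> extend_scalars (V i)"
    "\<And>i s. i \<in> I \<Longrightarrow> s \<in> S \<Longrightarrow> W *v E i s = s" by metis
  \<comment> \<open>The value 0 off \<open>S\<close> makes labels equal as functions once they agree
    on \<open>S\<close>.\<close>
  define c where "c i = (\<lambda>s. if s \<in> S then E i s else 0)" for i
  let ?U = "block c I V"
  define Y where "Y b = dual_code (G_sub \<iota> W (?U b))" for b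
  \<comment> \<open>Indices with label b share the preimage \<open>b s\<close>, so it lies in the
    extension of their intersection.\<close>
  have b_mem: "b s \<in> extend_scalars (?U b)" "W *v b s = s" if b: "b \<in> c ` I" and s: "s \<in> S" for b s
  proof -
    have "b s \<in> extend_scalars (V i)" if "i \<in> {i \<in> I. c i = b}" for i
      using that E(1)[OF _ s, of i] s by (auto simp: c_def)
    then show "b s \<in> extend_scalars (?U b)" using assms(3) by (intro extend_scalars_INT) auto
    show "W *v b s = s" using b E(2)[OF _ s] s by (auto simp: c_def)
  qed
  have deriv: "(\<Sum>i\<in>UNIV. \<eta> $ i * D a j (s $ i)) = b s $ j * \<eta> $ a"
    if "b \<in> c ` I" "s \<in> S" "\<eta> \<in> Y b" for b s \<eta> a j
    using annihilator_derivative[of \<eta> "?U b" "b s" a j] b_mem[OF that(1,2)] that(3) by (simp add: Y_def)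
  \<comment> \<open>The classical independence of eigenvectors for distinct eigenvalues, by
    induction on the set of labels.\<close>
  have indep: "(\<forall>b\<in>B. h b \<in> Y b) \<longrightarrow> (\<Sum>b\<in>B. h b) = 0 \<longrightarrow> (\<forall>b\<in>B. h b = 0)"
    if "finite B" "B \<subseteq> c ` I" for B h
    using that
  proof (induction B arbitrary: h)
    case empty
    then show ?case by simp
  next
    case (insert b0 B)
    show ?case
    proof (intro impI)
      assume h: "\<forall>b\<in>insert b0 B. h b \<in> Y b" and sum0: "(\<Sum>b\<in>insert b0 B. h b) = 0"
      have rel: "h b0 = - (\<Sum>b\<in>B. h b)" using sum0 insert by (simp add: eq_neg_iff_add_eq_0)
      \<comment> \<open>Apply the operator for s and j to the relation and subtract
        \<open>b0 s $ j\<close> times the relation: the term of \<open>b0\<close> drops out and the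
        induction hypothesis applies.\<close>
      have zero: "(b s $ j - b0 s $ j) *s h b = 0" if s: "s \<in> S" and b: "b \<in> B" for s j b
      proof -
        have "(\<Sum>b\<in>insert b0 B. b s $ j *s h b) = 0"
        proof -
          have "(\<Sum>b\<in>insert b0 B. b s $ j * h b $ a) = 0" for a
          proof -
            have "(\<Sum>b\<in>insert b0 B. b s $ j * h b $ a)
                = (\<Sum>b\<in>insert b0 B. \<Sum>i\<in>UNIV. h b $ i * D a j (s $ i))"
              using h insert.prems by (intro sum.cong refl deriv[OF _ s, symmetric]) auto
            also have "\<dots> = (\<Sum>i\<in>UNIV. \<Sum>b\<in>insert b0 B. h b $ i * D a j (s $ i))" by (rule sum.swap)
            also have "\<dots> = (\<Sum>i\<in>UNIV. (\<Sum>b\<in>insert b0 B. h b) $ i * D a j (s $ i))"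
              by (simp only: sum_component sum_distrib_right)
            finally show ?thesis unfolding sum0 by simp
          qed
          then show ?thesis by (simp only: vec_eq_iff sum_component vector_smult_component zero_index) simp
        qed
        then have "b0 s $ j *s h b0 + (\<Sum>b\<in>B. b s $ j *s h b) = 0" using insert by simp
        then have "(\<Sum>b\<in>B. (b s $ j - b0 s $ j) *s h b) = 0"
          unfolding rel
          by (simp add: vec.scale_sum_right vec.scale_left_diff_distrib sum_subtractf sum_negf)
        moreover have "\<forall>b\<in>B. (b s $ j - b0 s $ j) *s h b \<in> Y b"
        proof
          fix b assume "b \<in> B"
          then have "h b \<in> Y b" using h by simp
          then show "(b s $ j - b0 s $ j) *s h b \<in> Y b"
            unfolding Y_def by (rule vec.subspace_scale[OF dual_code_subspace])
        qed
        ultimately show ?thesis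
          using insert.IH[of "\<lambda>b. (b s $ j - b0 s $ j) *s h b"] insert.prems b by blast
      qed
      have "h b = 0" if b: "b \<in> B" for b
      proof (rule ccontr)
        assume "h b \<noteq> 0"
        then have eq: "b s = b0 s" if "s \<in> S" for s
          using zero[OF that b] by (simp add: vec_eq_iff[of "b s"])
        have "b = b0"
        proof
          fix s show "b s = b0 s"
          proof (cases "s \<in> S")
          case False
          moreover have "b \<in> c ` I" "b0 \<in> c ` I" using b insert.prems by auto
          ultimately show ?thesis by (auto simp: c_def)
          qed (rule eq)
        qed
        then show False using b insert.hyps by simp
      qed
      then show "\<forall>b\<in>insert b0 B. h b = 0" using rel by simp
    qed
  qed
  have "(\<Sum>b\<in>c ` I. vec.dim (Y b)) \<le> vec.dim (dual_code S)"
  proof (rule sum_dim_le_if_independent)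
    fix b assume b: "b \<in> c ` I"
    have "S \<subseteq> G_sub \<iota> W (?U b)"
      using b_mem[OF b] unfolding G_sub_eq by (intro subsetI image_eqI) auto
    then show "Y b \<subseteq> dual_code S" by (auto simp: Y_def dual_code_def)
  next
    fix h :: "('f^'k \<Rightarrow> 'f^'n) \<Rightarrow> 'f^'k"
    assume "\<And>b. b \<in> c ` I \<Longrightarrow> h b \<in> Y b" "(\<Sum>b\<in>c ` I. h b) = 0"
    then show "\<forall>b\<in>c ` I. h b = 0" using indep[of "c ` I" h] assms(1) by blast
  qed (use assms(1) in \<open>auto simp: Y_def dual_code_subspace\<close>)
  \<comment> \<open>Each \<open>Y b\<close> has dimension k - dim U_b and the annihilator of
    \<open>S\<close> has dimension k - dim S; comparing them gives the claim.\<close>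
  moreover have "vec.dim (Y b) + vec.dim (?U b) = CARD('k)" if "b \<in> c ` I" for b
  proof -
    have "vec.subspace (?U b)" using assms(3) by (rule block_subspace)
    moreover have "vec.dim (?U b) \<le> CARD('k)" using assms(4) that by (rule dim_block_le)
    ultimately have "vec.dim (G_sub \<iota> W (?U b)) = vec.dim (?U b)"
      using injective_up_to_k_generic unfolding injective_up_to_k_iff_dim by blast
    then show ?thesis using dim_dual_code[of "G_sub \<iota> W (?U b)"] by (simp add: Y_def)
  qed
  then have "(\<Sum>b\<in>c ` I. vec.dim (Y b) + vec.dim (?U b)) = card (c ` I) * CARD('k)"
    by (simp add: sum.cong)
  then have "(\<Sum>b\<in>c ` I. vec.dim (Y b)) + (\<Sum>b\<in>c ` I. vec.dim (?U b)) = card (c ` I) * CARD('k)"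
    unfolding sum.distrib .
  moreover have "vec.dim (dual_code S) + vec.dim S = CARD('k)" by (rule dim_dual_code)
  moreover have "card (c ` I) = Suc (card (c ` I) - 1)"
    using assms(1,2) by (simp add: card_gt_0_iff)
  then have "card (c ` I) * CARD('k) = CARD('k) + (card (c ` I) - 1) * CARD('k)"
    by (metis mult_Suc)
  ultimately have "vec.dim S + (card (c ` I) - 1) * CARD('k) \<le> (\<Sum>b\<in>c ` I. vec.dim (?U b))"
    by linarith
  then show thesis using that[of c] by (simp only: S_def)
qed

end

section \<open>List decodability\<close>

text \<open>Transposition moves \<open>G\<close> across the pairing: \<open>G\<close> is a
  parity-check matrix of the dual code.\<close>

lemma kernel_eq_dual_code:
  fixes G :: "'f::field^'n^'k"
  shows "dual_code (code_of G) = {v. G *v v = 0}"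
proof -
  have pair: "(\<Sum>j\<in>UNIV. v $ j * (transpose G *v u) $ j) = (\<Sum>i\<in>UNIV. u $ i * (G *v v) $ i)" for u v
  proof -
    have "(\<Sum>j\<in>UNIV. v $ j * (transpose G *v u) $ j) = (\<Sum>j\<in>UNIV. \<Sum>i\<in>UNIV. u $ i * (G $ i $ j * v $ j))"
      by (simp add: matrix_vector_mult_def transpose_def sum_distrib_left ac_simps)
    also have "\<dots> = (\<Sum>i\<in>UNIV. \<Sum>j\<in>UNIV. u $ i * (G $ i $ j * v $ j))" by (rule sum.swap)
    finally show ?thesis by (simp add: matrix_vector_mult_def sum_distrib_left)
  qed
  have zero: "G *v v = 0" if "\<And>u. (\<Sum>i\<in>UNIV. u $ i * (G *v v) $ i) = 0" for v
  proof -
    have "(G *v v) $ i = 0" for i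
      using that[of "axis i 1"] by (simp add: axis_def if_distrib if_distribR cong: if_cong)
    then show ?thesis by (simp add: vec_eq_iff)
  qed
  have mem: "v \<in> dual_code (code_of G) \<longleftrightarrow> (\<forall>u. (\<Sum>i\<in>UNIV. u $ i * (G *v v) $ i) = 0)" for v
    unfolding dual_code_def code_of_def pair[symmetric] by blast
  show ?thesis
  proof (intro set_eqI iffI)
    fix v assume "v \<in> dual_code (code_of G)"
    then show "v \<in> {v. G *v v = 0}" unfolding mem using zero by blast
  next
    fix v assume "v \<in> {v. G *v v = 0}"
    then show "v \<in> dual_code (code_of G)" unfolding mem by simp
  qed
qed

context extension_field
begin

lemma subspace_INT_G_sub: "vec.subspace (\<Inter>i\<in>A. G_sub \<iota> G (V i))"
  using subspace_G_sub by (blast intro: vec.subspace_Inter)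

text \<open>In terms of errors e = y - c with a common syndrome G e.\<close>
definition list_decodable :: "nat \<Rightarrow> 'f^'n^'k \<Rightarrow> bool" where
  "list_decodable L G \<longleftrightarrow> (\<forall>J s. finite J \<longrightarrow> card J = Suc L \<longrightarrow> (\<forall>e\<in>J. G *v e = s) \<longrightarrow>
     L * CARD('k) < (\<Sum>e\<in>J. rank_q \<iota> e))"

lemma list_decodableD:
  fixes G :: "'f^'n^'k"
  assumes "list_decodable L G" "finite J" "card J = Suc L" "\<And>e. e \<in> J \<Longrightarrow> G *v e = s"
  shows "L * CARD('k) < (\<Sum>e\<in>J. rank_q \<iota> e)"
  using assms unfolding list_decodable_def by blast

text \<open>Distinct codewords correspond to distinct errors with the syndrome of y, and the full
  rank of \<open>G\<close> gives the dual code codimension k.\<close>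

lemma LD_MRD_dual_code_iff:
  fixes G :: "'f^'n^'k"
  assumes "vec.dim (code_of G) = CARD('k)"
  shows "LD_MRD \<iota> L (dual_code (code_of G)) \<longleftrightarrow> list_decodable L G"
proof
  have dims: "CARD('n) - vec.dim (dual_code (code_of G)) = CARD('k)"
    using dim_dual_code[of "code_of G"] assms by linarith
  show "list_decodable L G" if LD: "LD_MRD \<iota> L (dual_code (code_of G))"
    unfolding list_decodable_def
  proof (intro allI impI)
    fix J s assume J: "finite J" "card J = Suc L" "\<forall>e\<in>J. G *v e = s"
    obtain g where g: "bij_betw g {0..L} J"
      using J finite_same_card_bij[of "{0..L}" J] by auto
    \<comment> \<open>With \<open>g 0\<close> itself as the received word, the codeword
      \<open>g 0 - g i\<close> has error \<open>g i\<close>.\<close>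
    define c where "c i = g 0 - g i" for i
    have "\<forall>i\<in>{0..L}. c i \<in> dual_code (code_of G)"
      using J(3) bij_betwE[OF g] by (simp add: kernel_eq_dual_code c_def matrix_vector_mult_diff_distrib)
    moreover have "inj_on c {0..L}"
      using bij_betw_imp_inj_on[OF g] by (auto simp: c_def inj_on_def)
    ultimately have "L * CARD('k) < (\<Sum>i=0..L. d_R \<iota> (g 0) (c i))"
      using LD unfolding LD_MRD_def dims by blast
    also have "\<dots> = (\<Sum>i=0..L. rank_q \<iota> (g i))" by (simp add: d_R_def c_def)
    also have "\<dots> = (\<Sum>e\<in>J. rank_q \<iota> e)" using g by (rule sum.reindex_bij_betw)
    finally show "L * CARD('k) < (\<Sum>e\<in>J. rank_q \<iota> e)" .
  qed
  show "LD_MRD \<iota> L (dual_code (code_of G))" if LD: "list_decodable L G"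
    unfolding LD_MRD_def dims
  proof (intro allI impI)
    fix y and c :: "nat \<Rightarrow> 'f^'n"
    assume c: "(\<forall>i\<in>{0..L}. c i \<in> dual_code (code_of G)) \<and> inj_on c {0..L}"
    define g where "g i = y - c i" for i
    have inj: "inj_on g {0..L}" using c by (auto simp: g_def inj_on_def)
    have "\<forall>e\<in>g ` {0..L}. G *v e = G *v y"
      using c by (simp add: kernel_eq_dual_code g_def matrix_vector_mult_diff_distrib)
    moreover have "card (g ` {0..L}) = Suc L" using card_image[OF inj] by simp
    ultimately have "L * CARD('k) < (\<Sum>e\<in>g ` {0..L}. rank_q \<iota> e)"
      using LD by (intro list_decodableD) auto
    also have "\<dots> = (\<Sum>i=0..L. d_R \<iota> y (c i))"
      unfolding sum.reindex[OF inj] by (simp add: d_R_def g_def)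
    finally show "L * CARD('k) < (\<Sum>i=0..L. d_R \<iota> y (c i))" .
  qed
qed

text \<open>A nonzero kernel vector of rank at most k would form, with 0, a forbidden list of two
  errors of syndrome 0.\<close>

lemma list_decodable_imp_injective:
  fixes G :: "'f^'n^'k"
  assumes "list_decodable 1 G"
  shows "injective_up_to_k G"
  unfolding injective_up_to_k_def
proof (intro allI impI)
  fix V e assume V: "vec.subspace V" "vec.dim V \<le> CARD('k)" "e \<in> extend_scalars V" "G *v e = 0"
  show "e = 0"
  proof (rule ccontr)
    assume "e \<noteq> 0"
    then have "1 * CARD('k) < (\<Sum>e\<in>{e, 0}. rank_q \<iota> e)"
      using V(4) by (intro list_decodableD[where s = 0, OF assms]) auto
    moreover have "rank_q \<iota> (0 :: 'f^'n) \<le> 0"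
      using rank_q_le_dim[of "{0}" "0 :: 'f^'n"] vec.subspace_0[OF subspace_extend_scalars[of "{0 :: 'q^'n}"]]
      by (simp add: vec.subspace_single_0)
    moreover have "rank_q \<iota> e \<le> CARD('k)" using rank_q_le_dim[OF V(1,3)] V(2) by simp
    ultimately show False using \<open>e \<noteq> 0\<close> by simp
  qed
qed

text \<open>Label i by a preimage of s in the extension of \<open>V i\<close>. The labels form a
  list with syndrome s, and the rank of a label is at most the dimension of its block.\<close>

lemma exists_block_gap:
  fixes G :: "'f^'n^'k"
  assumes "\<And>L. L \<in> {1..l} \<Longrightarrow> list_decodable L G" "finite I" "I \<noteq> {}" "card I \<le> Suc l"
    "\<And>i. i \<in> I \<Longrightarrow> vec.subspace (V i)" "\<And>i. i \<in> I \<Longrightarrow> vec.dim (V i) \<le> CARD('k)"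
    "s \<in> (\<Inter>i\<in>I. G_sub \<iota> G (V i))" "s \<noteq> 0"
  obtains c :: "'i \<Rightarrow> 'f^'n" where
    "(card (c ` I) - 1) * CARD('k) < (\<Sum>b\<in>c ` I. vec.dim (block c I V b))"
proof -
  have "\<forall>i\<in>I. \<exists>e. e \<in> extend_scalars (V i) \<and> G *v e = s"
    using assms(7) by (auto simp: G_sub_eq)
  then obtain c where c: "\<And>i. i \<in> I \<Longrightarrow> c i \<in> extend_scalars (V i)" "\<And>i. i \<in> I \<Longrightarrow> G *v c i = s" by metis
  have mem: "b \<in> extend_scalars (block c I V b)" for b
    using assms(5) c(1) by (intro extend_scalars_INT) auto
  have rank: "rank_q \<iota> b \<le> vec.dim (block c I V b)" for b
    using block_subspace[of I V c b] assms(5) mem by (intro rank_q_le_dim) auto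
  have "(card (c ` I) - 1) * CARD('k) < (\<Sum>b\<in>c ` I. vec.dim (block c I V b))"
  proof (cases "card (c ` I) = 1")
    \<comment> \<open>A single label means L = 0, outside the range of the bound; here s \<noteq> 0
      makes the block nonzero.\<close>
    case True
    then obtain b where b: "c ` I = {b}" by (auto simp: card_1_singleton_iff)
    then obtain i where i: "i \<in> I" "c i = b" by blast
    then have "G *v b = s" using c(2)[of i] by simp
    then have "b \<noteq> 0" using assms(8) by auto
    then have "\<not> extend_scalars (block c I V b) \<subseteq> {0}" using mem by blast
    then have "vec.dim (extend_scalars (block c I V b)) > 0"
      by (simp only: vec.dim_eq_0[symmetric] neq0_conv)
    then show ?thesis
      using dim_extend_scalars[OF block_subspace[of I V c b]] assms(5) by (simp add: b)
  next
    case False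
    moreover have "card (c ` I) \<le> Suc l" "card (c ` I) > 0"
      using card_image_le[OF assms(2), of c] assms(2,3,4) by (auto simp: card_gt_0_iff)
    ultimately have cc: "card (c ` I) - 1 \<in> {1..l}" "card (c ` I) = Suc (card (c ` I) - 1)" by auto
    have "(card (c ` I) - 1) * CARD('k) < (\<Sum>e\<in>c ` I. rank_q \<iota> e)"
    proof (rule list_decodableD[OF assms(1)[OF cc(1)] _ cc(2)])
      show "finite (c ` I)" using assms(2) by simp
      show "G *v e = s" if "e \<in> c ` I" for e using that c(2) by auto
    qed
    also have "\<dots> \<le> (\<Sum>b\<in>c ` I. vec.dim (block c I V b))" by (intro sum_mono rank)
    finally show ?thesis .
  qed
  then show thesis by (rule that)
qed

text \<open>Take the supports of a putative bad list (repeated to fill up the index set). The bound forces the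
  intersection over the blocks to have the same dimension as the whole intersection; so the common syndrome
  lies in every block intersection, and by injectivity no block contains two list elements.\<close>
lemma list_decodable_if_block_bound:
  fixes G :: "'f^'n^'k"
  assumes inj: "injective_up_to_k G" and fin: "finite I" and L: "1 \<le> L" "Suc L \<le> card I"
    and bound: "\<And>V. \<lbrakk>\<And>i. i \<in> I \<Longrightarrow> vec.subspace (V i); \<And>i. i \<in> I \<Longrightarrow> vec.dim (V i) \<le> CARD('k)\<rbrakk> \<Longrightarrow>
       \<exists>c :: 'i \<Rightarrow> 'b. vec.dim (\<Inter>i\<in>I. G_sub \<iota> G (V i)) + (card (c ` I) - 1) * CARD('k)
         \<le> (\<Sum>b\<in>c ` I. vec.dim (block c I V b))"
  shows "list_decodable L G"
proof -
  \<comment> \<open>First the lists whose errors all have supports of dimension at most k, as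
    \<open>bound\<close> demands.\<close>
  have small: "(card J - 1) * CARD('k) < (\<Sum>e\<in>J. rank_q \<iota> e)"
    if J: "finite J" "2 \<le> card J" "card J \<le> card I" "\<And>e. e \<in> J \<Longrightarrow> G *v e = s"
      "\<And>e. e \<in> J \<Longrightarrow> rank_q \<iota> e \<le> CARD('k)" for J s
  proof -
    define T where "T e = (SOME V. vec.subspace V \<and> e \<in> extend_scalars V \<and> vec.dim V \<le> rank_q \<iota> e)" for e :: "'f^'n"
    have T: "vec.subspace (T e) \<and> e \<in> extend_scalars (T e) \<and> vec.dim (T e) \<le> rank_q \<iota> e" for e
      unfolding T_def by (rule someI_ex, rule rank_q_attained[of e]) blast
    have Tk: "vec.dim (T e) \<le> CARD('k)" if "e \<in> J" for e
      using T[of e] J(5)[OF that] by linarith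
    have "J \<noteq> {}" using J(2) by auto
    obtain g where g: "inj_on g J" "g ` J \<subseteq> I" using card_le_inj[OF J(1) fin J(3)] by blast
    \<comment> \<open>Indices not assigned to a list element repeat an arbitrary one.\<close>
    define f where "f i = (if i \<in> g ` J then inv_into J g i else (SOME e. e \<in> J))" for i
    have fJ: "f i \<in> J" for i
    proof (cases "i \<in> g ` J")
      case True
      then show ?thesis unfolding f_def by (simp add: inv_into_into)
    next
      case False
      then show ?thesis unfolding f_def using \<open>J \<noteq> {}\<close> by (simp add: some_in_eq)
    qed
    have fg: "f (g e) = e" if "e \<in> J" for e using that g(1) by (simp add: f_def)
    define V where "V i = T (f i)" for i
    have V: "vec.subspace (V i)" "vec.dim (V i) \<le> CARD('k)" for i
      using T[of "f i"] Tk[OF fJ] by (simp_all add: V_def)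
    obtain c :: "'i \<Rightarrow> 'b" where c: "vec.dim (\<Inter>i\<in>I. G_sub \<iota> G (V i)) + (card (c ` I) - 1) * CARD('k)
         \<le> (\<Sum>b\<in>c ` I. vec.dim (block c I V b))"
      using bound[of V, OF V] by blast
    let ?S = "\<Inter>i\<in>I. G_sub \<iota> G (V i)" and ?S' = "\<Inter>b\<in>c ` I. G_sub \<iota> G (block c I V b)"
    have I: "I \<noteq> {}" using g(2) \<open>J \<noteq> {}\<close> by auto
    have s: "s \<in> ?S"
    proof
      fix i
      show "s \<in> G_sub \<iota> G (V i)"
        using T[of "f i"] J(4)[OF fJ, of i] unfolding V_def G_sub_eq by (intro image_eqI[of _ _ "f i"]) auto
    qed
    \<comment> \<open>Syndrome 0 would leave only the error 0. The resulting
      \<open>vec.dim ?S \<ge> 1\<close> makes the final inequality strict.\<close>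
    have "s \<noteq> 0"
    proof
      assume "s = 0"
      then have "e = 0" if "e \<in> J" for e
        using inj T[of e] Tk[OF that] J(4)[OF that] unfolding injective_up_to_k_def by blast
      then have "J \<subseteq> {0}" by blast
      then have "card J \<le> 1" using card_mono[of "{0}" J] by simp
      then show False using J(2) by simp
    qed
    then have "\<not> ?S \<subseteq> {0}" using s by blast
    then have "vec.dim ?S \<noteq> 0" by (simp only: vec.dim_eq_0) simp
    then have pos: "vec.dim ?S \<ge> 1" by linarith
    have "(\<Sum>b\<in>c ` I. vec.dim (block c I V b)) \<le> vec.dim ?S' + (card (c ` I) - 1) * CARD('k)"
      using inj fin I V by (intro sum_dim_block_le) auto
    then have "vec.dim ?S \<le> vec.dim ?S'" using c by linarith
    then have "?S' = ?S"
      by (intro vec.subspace_dim_equal INT_G_sub_block_subset subspace_INT_G_sub)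
    then have s': "s \<in> G_sub \<iota> G (block c I V (c i))" if "i \<in> I" for i
      using INT_D[of s "\<lambda>b. G_sub \<iota> G (block c I V b)" "c ` I" "c i"] s that by simp
    have ceq: "f i = f i'" if i: "i \<in> I" "i' \<in> I" "c i = c i'" for i i'
    proof -
      obtain u where u: "u \<in> extend_scalars (block c I V (c i))" "G *v u = s"
        using s'[OF i(1)] by (auto simp: G_sub_eq)
      have "u = f m" if m: "m \<in> I" "c m = c i" for m
      proof (rule injective_up_to_kD[OF inj V])
        show "u \<in> extend_scalars (V m)"
        proof (rule subsetD[OF extend_scalars_mono u(1)])
          show "block c I V (c i) \<subseteq> V m" using m by auto
        qed
        show "f m \<in> extend_scalars (V m)" using T[of "f m"] by (simp add: V_def)
        show "G *v u = G *v f m" using u(2) J(4)[OF fJ] by simp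
      qed
      from this[OF i(1) refl] this[OF i(2) i(3)[symmetric]] show ?thesis by simp
    qed
    have injcg: "inj_on (c \<circ> g) J"
    proof (rule inj_onI)
      fix x y assume xy: "x \<in> J" "y \<in> J" "(c \<circ> g) x = (c \<circ> g) y"
      then have "f (g x) = f (g y)" using g(2) by (intro ceq) auto
      then show "x = y" using xy fg by simp
    qed
    \<comment> \<open>Each list element has its own label, whose block lies in its support; every
      remaining label is charged k.\<close>
    define B where "B = (c \<circ> g) ` J"
    have B: "B \<subseteq> c ` I" using g(2) by (auto simp: B_def)
    have cardB: "card B = card J" unfolding B_def using injcg by (rule card_image)
    have finc: "finite (c ` I)" using fin by simp
    have "(\<Sum>b\<in>c ` I. vec.dim (block c I V b))
      = (\<Sum>b\<in>B. vec.dim (block c I V b)) + (\<Sum>b\<in>c ` I - B. vec.dim (block c I V b))"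
      using sum.subset_diff[OF B finc] by (simp add: add.commute)
    also have "(\<Sum>b\<in>B. vec.dim (block c I V b)) = (\<Sum>e\<in>J. vec.dim (block c I V (c (g e))))"
      unfolding B_def sum.reindex[OF injcg] by simp
    also have "\<dots> \<le> (\<Sum>e\<in>J. rank_q \<iota> e)"
    proof (rule sum_mono)
      fix e assume e: "e \<in> J"
      have "g e \<in> {i \<in> I. c i = c (g e)}" using e g(2) by auto
      then have "block c I V (c (g e)) \<subseteq> V (g e)" by (rule INT_lower)
      then have "vec.dim (block c I V (c (g e))) \<le> vec.dim (V (g e))" by (rule vec.dim_subset)
      also have "\<dots> \<le> rank_q \<iota> e" using T[of e] fg[OF e] by (simp add: V_def)
      finally show "vec.dim (block c I V (c (g e))) \<le> rank_q \<iota> e" .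
    qed
    also have "(\<Sum>b\<in>c ` I - B. vec.dim (block c I V b)) \<le> (\<Sum>b\<in>c ` I - B. CARD('k))"
      using V(2) by (intro sum_mono dim_block_le) auto
    also have "\<dots> = (card (c ` I) - card J) * CARD('k)"
      using B finc cardB by (simp add: card_Diff_subset finite_subset)
    finally have "1 + (card (c ` I) - 1) * CARD('k)
        \<le> (\<Sum>e\<in>J. rank_q \<iota> e) + (card (c ` I) - card J) * CARD('k)"
      using c pos by linarith
    moreover have "card J \<le> card (c ` I)" using card_mono[OF finc B] cardB by simp
    then have "(card (c ` I) - 1) = (card J - 1) + (card (c ` I) - card J)" using J(2) by simp
    then have "(card (c ` I) - 1) * CARD('k) = (card J - 1) * CARD('k) + (card (c ` I) - card J) * CARD('k)"
      by (metis add_mult_distrib)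
    ultimately show ?thesis by linarith
  qed
  show ?thesis
    unfolding list_decodable_def
  proof (intro allI impI)
    fix J s assume J: "finite J" "card J = Suc L" "\<forall>e\<in>J. G *v e = (s :: 'f^'k)"
    \<comment> \<open>An error of rank above k pays for one unit of L by itself, so only the others
      need \<open>small\<close>, provided that at least two remain.\<close>
    define J1 where "J1 = {e \<in> J. rank_q \<iota> e \<le> CARD('k)}"
    let ?r = "\<lambda>A. \<Sum>e\<in>A. rank_q \<iota> e"
    have J1: "J1 \<subseteq> J" "finite J1" using J by (auto simp: J1_def)
    have big: "card (J - J1) * Suc (CARD('k)) \<le> ?r (J - J1)"
    proof -
      have "(\<Sum>e\<in>J - J1. Suc (CARD('k))) \<le> ?r (J - J1)" by (intro sum_mono) (auto simp: J1_def)
      then show ?thesis by simp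
    qed
    have split: "?r J = ?r (J - J1) + ?r J1" using J1(1) J(1) by (rule sum.subset_diff)
    have cards: "card (J - J1) + card J1 = Suc L"
      using J1 J card_mono[OF J(1) J1(1)] by (simp add: card_Diff_subset)
    show "L * CARD('k) < ?r J"
    proof (cases "2 \<le> card J1")
      case True
      have "(card J1 - 1) * CARD('k) < ?r J1"
      proof (rule small[OF J1(2) True])
        show "card J1 \<le> card I" using J(2) L(2) card_mono[OF J(1) J1(1)] by simp
        show "G *v e = s" if "e \<in> J1" for e using that J(3) J1(1) by blast
        show "rank_q \<iota> e \<le> CARD('k)" if "e \<in> J1" for e using that by (simp add: J1_def)
      qed
      moreover have "L = card (J - J1) + (card J1 - 1)" using cards True by simp
      then have "L * CARD('k) = card (J - J1) * CARD('k) + (card J1 - 1) * CARD('k)"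
        by (metis add_mult_distrib)
      ultimately show ?thesis using big split by simp
    next
      case False
      \<comment> \<open>At least L errors have rank above k; they contribute L (k + 1), which
        suffices as L \<ge> 1.\<close>
      then have "L \<le> card (J - J1)" using cards by simp
      then have "L * Suc (CARD('k)) \<le> card (J - J1) * Suc (CARD('k))" by (rule mult_le_mono1)
      then show ?thesis using big split L(1) by simp
    qed
  qed
qed

end

section \<open>Comparison of \<open>G\<close> with the generic matrix\<close>

text \<open>If W has zero intersection but G does not, the gap of the blocks of a point in the latter forces a
  nonzero intersection for W. Otherwise shrink one subspace to a hyperplane that lowers the dimension for W;
  for G the dimension drops by at most one.\<close>
lemma dim_INT_G_sub_le_generic:
  fixes \<iota> :: "'q::field \<Rightarrow> 'f::field" and \<kappa> :: "'q \<Rightarrow> 'g::field"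
    and G :: "'f^'n^'k" and W :: "'g^'n^'k"
  assumes F: "extension_field \<iota>" and K: "extension_field \<kappa>"
    and injW: "extension_field.injective_up_to_k \<kappa> W"
    and I: "finite I" "I \<noteq> {}" "card I \<le> Suc l"
    and LD: "\<And>L. L \<in> {1..l} \<Longrightarrow> extension_field.list_decodable \<iota> L G"
    and V: "\<And>i. i \<in> I \<Longrightarrow> vec.subspace (V i)" "\<And>i. i \<in> I \<Longrightarrow> vec.dim (V i) \<le> CARD('k)"
  shows "vec.dim (\<Inter>i\<in>I. G_sub \<iota> G (V i)) \<le> vec.dim (\<Inter>i\<in>I. G_sub \<kappa> W (V i))"
  using V
proof (induction "vec.dim (\<Inter>i\<in>I. G_sub \<kappa> W (V i))" arbitrary: V rule: less_induct)
  case less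
  interpret F: extension_field \<iota> by (rule F)
  interpret K: extension_field \<kappa> by (rule K)
  let ?S = "\<lambda>V. \<Inter>i\<in>I. G_sub \<kappa> W (V i)" and ?R = "\<lambda>V. \<Inter>i\<in>I. G_sub \<iota> G (V i)"
  show ?case
  proof (cases "?S V \<subseteq> {0}")
    case True
    show ?thesis
    proof (rule ccontr)
      assume "\<not> ?thesis"
      then have "vec.dim (?R V) \<noteq> 0" by linarith
      then have "\<not> ?R V \<subseteq> {0}" by (simp only: vec.dim_eq_0) simp
      then obtain s where s: "s \<in> ?R V" "s \<noteq> 0" by blast
      obtain c :: "_ \<Rightarrow> 'f^'n" where c:
        "(card (c ` I) - 1) * CARD('k) < (\<Sum>b\<in>c ` I. vec.dim (F.block c I V b))"
        by (rule F.exists_block_gap[OF LD I less.prems s])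
      \<comment> \<open>Blocks do not depend on the matrix, so the counting bound for
        \<open>W\<close> applies to the labelling found for \<open>G\<close>.\<close>
      have "(\<Sum>b\<in>c ` I. vec.dim (F.block c I V b))
        \<le> vec.dim (\<Inter>b\<in>c ` I. G_sub \<kappa> W (F.block c I V b)) + (card (c ` I) - 1) * CARD('k)"
        using injW I(1,2) less.prems by (rule K.sum_dim_block_le)
      moreover have "vec.dim (\<Inter>b\<in>c ` I. G_sub \<kappa> W (F.block c I V b)) = 0"
        unfolding vec.dim_eq_0 using K.INT_G_sub_block_subset True by (rule subset_trans)
      ultimately show False using c by linarith
    qed
  next
    case False
    obtain s where s: "s \<in> ?S V" "s \<noteq> 0"
      using False by blast
    obtain i where i: "i \<in> I" using I(2) by blast
    then obtain e where e: "e \<in> K.extend_scalars (V i)" "W *v e = s"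
      using s(1) by (auto simp: K.G_sub_eq)
    have "e \<noteq> 0" using e(2) s(2) by auto
    then obtain H v where H: "vec.subspace H" "H \<subseteq> V i" "V i \<subseteq> vec.span (insert v H)"
        "e \<notin> K.extend_scalars H"
      by (rule K.exists_hyperplane_avoiding[OF less.prems(1)[OF i] e(1)])
    define V' where "V' = V(i := H)"
    have V': "\<And>m. m \<in> I \<Longrightarrow> vec.subspace (V' m)" "\<And>m. m \<in> I \<Longrightarrow> vec.dim (V' m) \<le> CARD('k)"
      using less.prems H(1) order_trans[OF vec.dim_subset[OF H(2)] less.prems(2)[OF i]]
      by (auto simp: V'_def)
    \<comment> \<open>The preimage of s in the extension of \<open>V i\<close> is unique and avoids
      that of H, so the cut removes s.\<close>
    have "s \<notin> G_sub \<kappa> W H"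
    proof
      assume "s \<in> G_sub \<kappa> W H"
      then obtain e' where e': "e' \<in> K.extend_scalars H" "W *v e' = s" by (auto simp: K.G_sub_eq)
      have "e = e'"
      proof (rule K.injective_up_to_kD[OF injW less.prems(1)[OF i] less.prems(2)[OF i] e(1)])
        show "e' \<in> K.extend_scalars (V i)" using e'(1) K.extend_scalars_mono[OF H(2)] by blast
        show "W *v e = W *v e'" using e(2) e'(2) by simp
      qed
      then show False using e' H(4) by simp
    qed
    then have "s \<notin> ?S V'" using i by (auto simp: V'_def)
    moreover have "?S V' \<subseteq> ?S V"
    proof (intro INT_greatest subsetI)
      fix x m assume "x \<in> ?S V'" "m \<in> I"
      then have "x \<in> G_sub \<kappa> W (V' m)" by blast
      then show "x \<in> G_sub \<kappa> W (V m)"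
        using K.G_sub_mono[OF H(2), of W] by (cases "m = i") (auto simp: V'_def)
    qed
    ultimately have "?S V' \<subset> ?S V" using s(1) by (intro psubsetI) auto
    then have "vec.span (?S V') \<subset> vec.span (?S V)"
      unfolding vec.span_eq_iff[THEN iffD2, OF K.subspace_INT_G_sub] .
    then have lt: "vec.dim (?S V') < vec.dim (?S V)" by (rule vec.dim_psubset)
    then have "vec.dim (?R V') \<le> vec.dim (?S V')" using V' by (rule less.hyps)
    moreover have "vec.dim (?R V) \<le> Suc (vec.dim (?R V'))"
    proof -
      have "?R V = (\<Inter>m\<in>I - {i}. G_sub \<iota> G (V m)) \<inter> G_sub \<iota> G (V i)" using i by auto
      moreover have "?R V' = (\<Inter>m\<in>I - {i}. G_sub \<iota> G (V m)) \<inter> G_sub \<iota> G H"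
      proof -
        have "?R V' = G_sub \<iota> G (V' i) \<inter> (\<Inter>m\<in>I - {i}. G_sub \<iota> G (V' m))" using i by auto
        also have "(\<Inter>m\<in>I - {i}. G_sub \<iota> G (V' m)) = (\<Inter>m\<in>I - {i}. G_sub \<iota> G (V m))"
          by (intro INF_cong) (auto simp: V'_def)
        finally show ?thesis by (simp add: V'_def Int_commute)
      qed
      ultimately show ?thesis using F.dim_Int_G_sub_hyperplane[OF F.subspace_INT_G_sub H(3,2)] by simp
    qed
    ultimately show ?thesis using lt by linarith
  qed
qed

theorem mainTheorem5:
  fixes \<iota> :: "'q::{finite,field} \<Rightarrow> 'f::field"
    and G :: "'f^'n^'k"
    and l :: nat
  assumes "field_embedding \<iota>"
    and "vec.dim (code_of G) = CARD('k)"
    and "l \<ge> 1"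
  shows "MRD \<iota> (l + 1) G \<longleftrightarrow> LD_MRD_le \<iota> l (dual_code (code_of G))"
proof -
  interpret F: extension_field \<iota> by unfold_locales (rule assms(1))
  define W where "W = (generic_matrix :: ('q ratfun)^'n^'k)"
  have "\<exists>D :: 'q ratfun \<Rightarrow> 'q ratfun. (\<forall>a b. D (a + b) = D a + D b) \<and> (\<forall>a b. D (a * b) = D a * b + a * D b)
      \<and> (\<forall>c. D (ratfun_const c) = 0) \<and> (\<forall>y. D (ratfun_var y) = (if y = x then 1 else 0))" for x
    by (rule exists_partial_derivative[of x]) blast
  then obtain \<delta> :: "nat \<Rightarrow> 'q ratfun \<Rightarrow> 'q ratfun" where
    \<delta>: "\<And>x a b. \<delta> x (a + b) = \<delta> x a + \<delta> x b" "\<And>x a b. \<delta> x (a * b) = \<delta> x a * b + a * \<delta> x b"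
      "\<And>x c. \<delta> x (ratfun_const c) = 0" "\<And>x y. \<delta> x (ratfun_var y) = (if y = x then 1 else 0)"
    by metis
  let ?idx = "to_nat_on (UNIV :: ('k \<times> 'n) set)"
  \<comment> \<open>Distinct positions carry distinct variables, so the derivative by one entry
    vanishes on all others.\<close>
  have "inj ?idx" by (rule inj_on_to_nat_on) (simp add: uncountable_infinite)
  then have idx: "?idx p = ?idx p' \<longleftrightarrow> p = p'" for p p' by (simp add: inj_eq)
  interpret K: generic_code ratfun_const W "\<lambda>a j. \<delta> (?idx (a, j))"
  proof
    show "field_embedding (ratfun_const :: 'q \<Rightarrow> 'q ratfun)" by (rule field_embedding_ratfun_const)
    fix i a :: 'k and l j :: 'n
    have "\<delta> (?idx (a, j)) (W $ i $ l) = (if ?idx (i, l) = ?idx (a, j) then 1 else 0)"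
      by (simp add: W_def generic_matrix_def \<delta>(4))
    then show "\<delta> (?idx (a, j)) (W $ i $ l) = (if i = a \<and> l = j then 1 else 0)" by (simp add: idx)
  qed (simp_all add: \<delta>)
  have W_sub: "W_sub V = G_sub ratfun_const W V" for V :: "('q^'n) set"
    by (simp add: W_sub_def G_sub_def W_def)
  let ?I = "{1..l + 1}"
  have I: "finite ?I" "?I \<noteq> {}" "card ?I \<le> Suc l" by auto
  have LD: "LD_MRD_le \<iota> l (dual_code (code_of G)) \<longleftrightarrow> (\<forall>L\<in>{1..l}. F.list_decodable L G)"
    by (simp add: LD_MRD_le_def F.LD_MRD_dual_code_iff[OF assms(2)])
  show ?thesis
    unfolding LD
  proof
    assume MRD: "MRD \<iota> (l + 1) G"
    have eq: "vec.dim (\<Inter>i\<in>?I. G_sub \<iota> G (V i)) = vec.dim (\<Inter>i\<in>?I. G_sub ratfun_const W (V i))"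
      if "\<And>i. i \<in> ?I \<Longrightarrow> vec.subspace (V i)" "\<And>i. i \<in> ?I \<Longrightarrow> vec.dim (V i) \<le> CARD('k)"
      for V :: "nat \<Rightarrow> ('q^'n) set"
      using MRD that unfolding MRD_def W_sub by blast
    have inj: "F.injective_up_to_k G"
      unfolding F.injective_up_to_k_iff_dim
    proof (intro allI impI)
      fix V :: "('q^'n) set" assume V: "vec.subspace V" "vec.dim V \<le> CARD('k)"
      \<comment> \<open>For the constant family the intersection is the single subspace
        itself.\<close>
      have "vec.dim (G_sub \<iota> G V) = vec.dim (G_sub ratfun_const W V)"
        using eq[of "\<lambda>_. V"] V by simp
      then show "vec.dim (G_sub \<iota> G V) = vec.dim V"
        using K.injective_up_to_k_generic V unfolding K.injective_up_to_k_iff_dim by simp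
    qed
    show "\<forall>L\<in>{1..l}. F.list_decodable L G"
    proof
      fix L assume L: "L \<in> {1..l}"
      show "F.list_decodable L G"
      proof (rule F.list_decodable_if_block_bound[OF inj I(1)])
        fix V :: "nat \<Rightarrow> ('q^'n) set"
        assume V: "\<And>i. i \<in> ?I \<Longrightarrow> vec.subspace (V i)" "\<And>i. i \<in> ?I \<Longrightarrow> vec.dim (V i) \<le> CARD('k)"
        have dims: "vec.dim (\<Inter>i\<in>?I. G_sub \<iota> G (V i)) = vec.dim (\<Inter>i\<in>?I. G_sub ratfun_const W (V i))"
          using V by (rule eq)
        \<comment> \<open>The labelling that is sharp for \<open>W\<close> serves \<open>G\<close>,
          since the two intersections have equal dimension.\<close>
        show "\<exists>c :: nat \<Rightarrow> 'q ratfun^'k \<Rightarrow> 'q ratfun^'n.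
          vec.dim (\<Inter>i\<in>?I. G_sub \<iota> G (V i)) + (card (c ` ?I) - 1) * CARD('k)
            \<le> (\<Sum>b\<in>c ` ?I. vec.dim (F.block c ?I V b))"
          by (rule K.dim_INT_generic_le[where V = V, OF I(1,2) V]) (use dims in auto)
      qed (use L in auto)
    qed
  next
    assume LD: "\<forall>L\<in>{1..l}. F.list_decodable L G"
    then have inj: "F.injective_up_to_k G"
      using assms(3) by (intro F.list_decodable_imp_injective) simp
    show "MRD \<iota> (l + 1) G"
      unfolding MRD_def W_sub
    proof (intro allI impI antisym)
      fix V :: "nat \<Rightarrow> ('q^'n) set"
      assume "\<forall>i\<in>?I. vec.subspace (V i) \<and> vec.dim (V i) \<le> CARD('k)"
      then have V: "\<And>i. i \<in> ?I \<Longrightarrow> vec.subspace (V i)" "\<And>i. i \<in> ?I \<Longrightarrow> vec.dim (V i) \<le> CARD('k)"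
        by auto
      show "vec.dim (\<Inter>i\<in>?I. G_sub \<iota> G (V i)) \<le> vec.dim (\<Inter>i\<in>?I. G_sub ratfun_const W (V i))"
        using LD by (intro dim_INT_G_sub_le_generic[OF F.extension_field_axioms K.extension_field_axioms
              K.injective_up_to_k_generic I _ V]) auto
      \<comment> \<open>The sharp labelling for \<open>W\<close> meets the counting bound for
        \<open>G\<close>; the terms (number of labels - 1) k cancel.\<close>
      obtain c :: "nat \<Rightarrow> 'q ratfun^'k \<Rightarrow> 'q ratfun^'n" where
        "vec.dim (\<Inter>i\<in>?I. G_sub ratfun_const W (V i)) + (card (c ` ?I) - 1) * CARD('k)
          \<le> (\<Sum>b\<in>c ` ?I. vec.dim (K.block c ?I V b))"
        by (rule K.dim_INT_generic_le[where V = V, OF I(1,2) V])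
      also have "\<dots> \<le> vec.dim (\<Inter>b\<in>c ` ?I. G_sub \<iota> G (K.block c ?I V b)) + (card (c ` ?I) - 1) * CARD('k)"
        using inj I(1,2) V by (rule F.sum_dim_block_le)
      also have "vec.dim (\<Inter>b\<in>c ` ?I. G_sub \<iota> G (K.block c ?I V b)) \<le> vec.dim (\<Inter>i\<in>?I. G_sub \<iota> G (V i))"
        by (intro vec.dim_subset F.INT_G_sub_block_subset)
      finally show "vec.dim (\<Inter>i\<in>?I. G_sub ratfun_const W (V i)) \<le> vec.dim (\<Inter>i\<in>?I. G_sub \<iota> G (V i))"
        by simp
    qed
  qed
qed

end
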